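(* Let $\mathbf{e}_1,\dots,\mathbf{e}_N$ be samples of the innovation vector $\mathbf{e}\sim\mathbb{P}_{\mathbf{e}}$ and suppose: (i) there are $\alpha>1$, $\beta>0$ with $\mathbb{E}^{\mathbf{e}\sim\mathbb{P}_{\mathbf{e}}}[\exp(\beta\|\mathbf{e}\|^\alpha)]<+\infty$; (ii) $d_W(\overline{\mathbb{P}}_{\mathbf{e}},\mathbb{P}_{\mathbf{e}})\le\kappa$; (iii) $\|\Delta\|\le\gamma_1$, $\|\tilde\Theta\|\le\gamma_2$, $\|\tilde{\mathbf{y}}_0\|\le\gamma_3$; (iv) the real-valued functions $h$ and $g$ are convex and Lipschitz continuous with Lipschitz constants $l_h$ and $l_g$, respectively. Let $\rho\in[0,1)$ and $\sigma>0$, and consider the optimization problem $$\min_{\overline\varepsilon,\hat\Phi,\hat\phi,s_i,q_i}\ l_h\overline\varepsilon+\frac1N\sum_{i=1}^N s_i$$ subject to $$\begin{bmatrix} I & -\hat{\mathbf{G}}\end{bmatrix}\begin{bmatrix}\hat\Phi_y&\hat\phi_y\\ \hat\Phi_u&\hat\phi_u\end{bmatrix}=\begin{bmatrix} I & 0\end{bmatrix},\qquad \hat{\bm\eta}_i=\begin{bmatrix}\hat\Phi_y&\hat\phi_y\\ \hat\Phi_u&\hat\phi_u\end{bmatrix}\begin{bmatrix}\hat{\mathbf{y}}_0+\hat\Theta\mathbf{e}_i\\ 1\end{bmatrix},$$ $\hat\Phi_y$ block-lower-triangular, $\hat\Phi_u$ block strictly-lower-triangular, $$h(\hat{\bm\eta}_i)\le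 s_i,\quad g(\hat{\bm\eta}_i)\le q_i\quad (i=1,\dots,N),\qquad l_g\overline\varepsilon+\frac1N\sum_{i=1}^N q_i\le 0,$$ $$\overline\varepsilon\ \ge\ \frac{\|\hat\Phi\|}{N(1-\rho)}\Big[\sum_{i=1}^N\big(\rho\|\hat{\mathbf{y}}_0+\hat\Theta\mathbf{e}_i\|+\gamma_2\|\mathbf{e}_i\|\big)+N\gamma_3\Big]+\Big(\frac{\rho}{\gamma_1}+\sigma\Big)\frac{\gamma_1}{1-\rho}\|\hat\phi_u\|+\frac{\kappa}{1-\rho}\|\hat\Phi\|\big(\|\hat\Theta\|+\gamma_2\big),$$ $$\|\hat\Phi_y\|\le\sigma,\qquad \gamma_1\|\hat\Phi_u\|\le\rho.$$ Then this problem is a convex relaxation of the DR-SLS problem (defined in the context), in the following sense. It is a convex optimization problem (for the given $\rho,\sigma$), and for every feasible point: (a) $d_W(\overline{\mathbb{P}}^{\hat{\mathcal M}},\mathbb{P}^{\mathcal M})\le\overline\varepsilon$; (b) $(\hat\Phi_y,\hat\Phi_u,\hat\phi_y,\hat\phi_u)$ is feasible for the DR-SLS problem with ambiguity radius $\varepsilon=\overline\varepsilon$, in particular $\sup_{\mathbb{Q}\in\mathcal{B}_{\overline\varepsilon}(\overline{\mathbb{P}}^{\hat{\mathcal M}})}\mathbb{E}^{\bm\eta\sim\mathbb{Q}}[g(\bm\eta)]\le0$; (c) $\sup_{\mathbb{Q}\in\mathcal{B}_{\overline\varepsilon}(\overline{\mathbb{P}}^{\hat{\mathcal M}})}\mathbb{E}^{\bm\eta\sim\mathbb{Q}}[h(\bm\eta)]\le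 l_h\overline\varepsilon+\frac1N\sum_{i=1}^N s_i$.
   Context: Norms: $\|\cdot\|$ is the 1-norm for vectors and the induced 1-norm for matrices; Lipschitz continuity is with respect to it. System: over times $0,\dots,T$, with $u_t\in\mathbb{R}^m$, $y_t,e_t\in\mathbb{R}^q$ and stacked vectors $\mathbf{y},\mathbf{u},\mathbf{e}$, the true system is $\mathbf{y}=\mathbf{G}\mathbf{u}+\mathbf{y}_0+\Theta\mathbf{e}$. It is the stacked form of $x_{t+1}=Ax_t+Bu_t+Le_t$, $y_t=Cx_t+Du_t+e_t$: $\mathbf{G}=\mathbf{C}\mathbf{T}_u+\mathbf{D}$ and $\Theta=\mathbf{C}\mathbf{T}_e+I$, where $\mathbf{C},\mathbf{D}$ are block diagonal with $T+1$ copies of $C$, $D$, and $\mathbf{T}_u$ (resp. $\mathbf{T}_e$) has $(i,j)$ block $A^{i-j-1}B$ (resp. $A^{i-j-1}L$) for $i>j$ and $0$ otherwise; $\mathbf{y}_0$ is a fixed vector determined by past data. Matrices are partitioned into $(T+1)\times(T+1)$ blocks (size $q$ for output, $m$ for input coordinates); block-lower-triangular means $(i,j)$ block zero for $j>i$, block strictly-lower-triangular means zero for $j\ge i$. $\mathbf{G}$ is block-lower-triangular. Nominal parameters $(\hat{\mathbf{G}},\hat\Theta,\hat{\mathbf{y}}_0)$ of the same sizes are given, with $\hat{\mathbf{G}}$ block-lower-triangular; $\Delta:=\mathbf{G}-\hat{\mathbf{G}}$, $\tilde\Theta:=\Theta-\hat\Theta$, $\tilde{\mathbf{y}}_0:=\mathbf{y}_0-\hat{\mathbf{y}}_0$.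 $\gamma_1>0$, and $\gamma_2,\gamma_3,\kappa\ge0$. Decision variables: $\hat\Phi=\begin{bmatrix}\hat\Phi_y\\ \hat\Phi_u\end{bmatrix}$, $\hat\phi=\begin{bmatrix}\hat\phi_y\\ \hat\phi_u\end{bmatrix}$ with $\hat\Phi_y\in\mathbb{R}^{q(T+1)\times q(T+1)}$, $\hat\Phi_u\in\mathbb{R}^{m(T+1)\times q(T+1)}$, $\hat\phi_y\in\mathbb{R}^{q(T+1)}$, $\hat\phi_u\in\mathbb{R}^{m(T+1)}$, and real scalars $\overline\varepsilon,s_i,q_i$ (the scalars $q_i$ are unrelated to the dimension $q$). Closed-loop responses: with $$R_\Phi=(I-\Delta\hat\Phi_u)^{-1},\qquad R_\phi=\begin{bmatrix} I&\hat\Phi_yR_\Phi\Delta\\0&I+\hat\Phi_uR_\Phi\Delta\end{bmatrix},$$ the true closed-loop output-input response $\bm\eta=\mathrm{col}(\mathbf{y},\mathbf{u})$ under the policy $\mathbf{u}=\mathbf{K}\mathbf{y}+\mathbf{p}$, $\mathbf{K}=\hat\Phi_u\hat\Phi_y^{-1}$, $\mathbf{p}=\hat\phi_u-\mathbf{K}\hat\phi_y$, is $$\bm\eta=\hat\Phi R_\Phi(\mathbf{y}_0+\Theta\mathbf{e})+R_\phi\hat\phi. \quad ( * )$$ $\mathbb{P}^{\mathcal M}$ is the distribution of $\bm\eta$ when $\mathbf{e}\sim\mathbb{P}_{\mathbf{e}}$. With $\delta(\cdot)$ the Dirac distribution, $\overline{\mathbb{P}}_{\mathbf{e}}=\frac1N\sum_{i=1}^N\delta(\mathbf{e}_i)$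 and $\overline{\mathbb{P}}^{\hat{\mathcal M}}=\frac1N\sum_{i=1}^N\delta(\hat{\bm\eta}_i)$, $\hat{\bm\eta}_i=\hat\Phi(\hat{\mathbf{y}}_0+\hat\Theta\mathbf{e}_i)+\hat\phi$. Wasserstein distance: for $\Xi$ the Euclidean space in which the random variable takes values and $\mathcal{H}(\Xi)$ the set of probability distributions $\mathbb{Q}$ on $\Xi$ with $\int\|\xi\|\,\mathbb{Q}(d\xi)<\infty$, $d_W(\mathbb{Q}_1,\mathbb{Q}_2)=\inf_\Pi\int_{\Xi^2}\|\xi_1-\xi_2\|\,\Pi(d\xi_1,d\xi_2)$ over couplings $\Pi$ of $\mathbb{Q}_1,\mathbb{Q}_2$. $\mathcal{B}_\varepsilon(\mathbb{Q}_0)=\{\mathbb{Q}\in\mathcal{H}(\Xi): d_W(\mathbb{Q},\mathbb{Q}_0)\le\varepsilon\}$. DR-SLS problem with radius $\varepsilon$: $$\min_{\hat\Phi_y,\hat\Phi_u,\hat\phi_y,\hat\phi_u}\ \sup_{\mathbb{Q}\in\mathcal{B}_\varepsilon(\overline{\mathbb{P}}^{\hat{\mathcal M}})}\mathbb{E}^{\bm\eta\sim\mathbb{Q}}[h(\bm\eta)]\quad\text{s.t.}\quad \sup_{\mathbb{Q}\in\mathcal{B}_\varepsilon(\overline{\mathbb{P}}^{\hat{\mathcal M}})}\mathbb{E}^{\bm\eta\sim\mathbb{Q}}[g(\bm\eta)]\le0,\quad \begin{bmatrix} I & -\hat{\mathbf{G}}\end{bmatrix}\begin{bmatrix}\hat\Phi_y&\hat\phi_y\\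 \hat\Phi_u&\hat\phi_u\end{bmatrix}=\begin{bmatrix} I & 0\end{bmatrix},$$ with $\hat\Phi_y$ block-lower-triangular, $\hat\Phi_u$ block strictly-lower-triangular, and the true response given by $( * )$. The radius is meant to be chosen so that the ball contains $\mathbb{P}^{\mathcal M}$. *)

theory Defs
  imports "HOL-Probability.Probability"
begin

text \<open>
  Time steps \<open>0, \<dots>, T\<close> are the elements of a finite linear order \<open>'t\<close> with \<open>CARD('t) = T + 1\<close>.
  A stacked signal of dimension \<open>'d\<close> is a vector indexed by pairs (time, component); the
  output-input vector \<open>col(y, u)\<close> is indexed by the disjoint sum of the two index types.
\<close>

type_synonym ('t, 'd) traj = "real ^ ('t \<times> 'd)"
type_synonym ('t, 'r, 'c) bmat = "real ^ ('t \<times> 'c) ^ ('t \<times> 'r)"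
type_synonym ('t, 'q, 'm) io = "real ^ (('t \<times> 'q) + ('t \<times> 'm))"
type_synonym ('t, 'q, 'm) resp = "real ^ ('t \<times> 'q) ^ (('t \<times> 'q) + ('t \<times> 'm))"

subsection \<open>Norms\<close>

definition norm1 :: "real ^ 'i::finite \<Rightarrow> real" where
  "norm1 x = (\<Sum>i\<in>UNIV. \<bar>x $ i\<bar>)"

text \<open>The induced norm; the quotient is \<open>0\<close> at \<open>x = 0\<close>.\<close>
definition mnorm1 :: "real ^ 'c::finite ^ 'r::finite \<Rightarrow> real" where
  "mnorm1 M = (SUP x. norm1 (M *v x) / norm1 x)"

definition lipschitz1 :: "real \<Rightarrow> (real ^ 'i::finite \<Rightarrow> real) \<Rightarrow> bool" where
  "lipschitz1 l f \<longleftrightarrow> 0 \<le> l \<and> (\<forall>x y. \<bar>f x - f y\<bar> \<le> l * norm1 (x - y))"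

subsection \<open>Block matrices and the true system\<close>

definition time_ix :: "'t::{finite, linorder} \<Rightarrow> nat" where
  "time_ix t = card {s. s < t}"

text \<open>The power operator on the type \<open>real ^ 'n ^ 'n\<close> is entrywise, hence the explicit iteration.\<close>
definition mpow :: "real ^ 'n::finite ^ 'n \<Rightarrow> nat \<Rightarrow> real ^ 'n ^ 'n" where
  "mpow A k = ((\<lambda>M. A ** M) ^^ k) (mat 1)"

definition block_diag ::
  "real ^ 'c::finite ^ 'r::finite \<Rightarrow> ('t::{finite, linorder}, 'r, 'c) bmat" where
  "block_diag M = (\<chi> i j. if fst i = fst j then M $ snd i $ snd j else 0)"

text \<open>Block \<open>(i, j)\<close> is \<open>A\<^sup>i\<^sup>-\<^sup>j\<^sup>-\<^sup>1 B\<close> for \<open>i > j\<close>.\<close>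
definition input_to_state ::
  "real ^ 'n::finite ^ 'n \<Rightarrow> real ^ 'c::finite ^ 'n \<Rightarrow> ('t::{finite, linorder}, 'n, 'c) bmat" where
  "input_to_state A B = (\<chi> i j.
     if fst j < fst i
     then (mpow A (time_ix (fst i) - time_ix (fst j) - 1) ** B) $ snd i $ snd j
     else 0)"

definition stacked_G ::
  "real ^ 'n::finite ^ 'n \<Rightarrow> real ^ 'm::finite ^ 'n \<Rightarrow> real ^ 'n ^ 'q::finite \<Rightarrow> real ^ 'm ^ 'q
    \<Rightarrow> ('t::{finite, linorder}, 'q, 'm) bmat" where
  "stacked_G A B C D = (block_diag C :: ('t, 'q, 'n) bmat) ** input_to_state A B + block_diag D"

definition stacked_Theta ::
  "real ^ 'n::finite ^ 'n \<Rightarrow> real ^ 'q::finite ^ 'n \<Rightarrow> real ^ 'n ^ 'q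
    \<Rightarrow> ('t::{finite, linorder}, 'q, 'q) bmat" where
  "stacked_Theta A L C = (block_diag C :: ('t, 'q, 'n) bmat) ** input_to_state A L + mat 1"

definition block_lower_tri ::
  "('t::{finite, linorder}, 'r::finite, 'c::finite) bmat \<Rightarrow> bool" where
  "block_lower_tri M \<longleftrightarrow> (\<forall>i j. fst i < fst j \<longrightarrow> M $ i $ j = 0)"

definition block_strictly_lower_tri ::
  "('t::{finite, linorder}, 'r::finite, 'c::finite) bmat \<Rightarrow> bool" where
  "block_strictly_lower_tri M \<longleftrightarrow> (\<forall>i j. fst i \<le> fst j \<longrightarrow> M $ i $ j = 0)"

text \<open>These apply both to vectors and, row-wise, to matrices.\<close>
definition y_part :: "'a ^ ('i::finite + 'j::finite) \<Rightarrow> 'a ^ 'i" where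
  "y_part v = (\<chi> i. v $ Inl i)"

definition u_part :: "'a ^ ('i::finite + 'j::finite) \<Rightarrow> 'a ^ 'j" where
  "u_part v = (\<chi> j. v $ Inr j)"

definition block2x2 ::
  "real ^ 'a::finite ^ 'c::finite \<Rightarrow> real ^ 'b::finite ^ 'c \<Rightarrow> real ^ 'a ^ 'd::finite \<Rightarrow> real ^ 'b ^ 'd
    \<Rightarrow> real ^ ('a + 'b) ^ ('c + 'd)" where
  "block2x2 M11 M12 M21 M22 = (\<chi> i j.
     case i of
       Inl r \<Rightarrow> (case j of Inl c \<Rightarrow> M11 $ r $ c | Inr c \<Rightarrow> M12 $ r $ c)
     | Inr r \<Rightarrow> (case j of Inl c \<Rightarrow> M21 $ r $ c | Inr c \<Rightarrow> M22 $ r $ c))"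

subsection \<open>Closed-loop responses\<close>

definition R_Phi ::
  "('t::{finite, linorder}, 'q::finite, 'm::finite) bmat \<Rightarrow> ('t, 'q, 'm) resp
    \<Rightarrow> ('t, 'q, 'q) bmat" where
  "R_Phi \<Delta> \<Phi> = matrix_inv (mat 1 - \<Delta> ** u_part \<Phi>)"

definition R_phi ::
  "('t::{finite, linorder}, 'q::finite, 'm::finite) bmat \<Rightarrow> ('t, 'q, 'm) resp
    \<Rightarrow> real ^ (('t \<times> 'q) + ('t \<times> 'm)) ^ (('t \<times> 'q) + ('t \<times> 'm))" where
  "R_phi \<Delta> \<Phi> = block2x2
     (mat 1) (y_part \<Phi> ** R_Phi \<Delta> \<Phi> ** \<Delta>)
     0       (mat 1 + u_part \<Phi> ** R_Phi \<Delta> \<Phi> ** \<Delta>)"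

definition true_response ::
  "('t::{finite, linorder}, 'q::finite, 'm::finite) bmat \<Rightarrow> ('t, 'q, 'q) bmat \<Rightarrow> ('t, 'q) traj
    \<Rightarrow> ('t, 'q, 'm) resp \<Rightarrow> ('t, 'q, 'm) io \<Rightarrow> ('t, 'q) traj \<Rightarrow> ('t, 'q, 'm) io" where
  "true_response \<Delta> \<Theta> y0 \<Phi> \<phi> e =
     (\<Phi> ** R_Phi \<Delta> \<Phi>) *v (y0 + \<Theta> *v e) + R_phi \<Delta> \<Phi> *v \<phi>"

definition nominal_response ::
  "('t::{finite, linorder}, 'q::finite, 'q) bmat \<Rightarrow> ('t, 'q) traj
    \<Rightarrow> ('t, 'q, 'm::finite) resp \<Rightarrow> ('t, 'q, 'm) io \<Rightarrow> ('t, 'q) traj \<Rightarrow> ('t, 'q, 'm) io" where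
  "nominal_response \<Theta>h y0h \<Phi> \<phi> e = \<Phi> *v (y0h + \<Theta>h *v e) + \<phi>"

text \<open>
  The pair \<open>\<eta> = col(y, u)\<close> satisfies the true system equation and the policy \<open>u = K y + p\<close>
  with \<open>K = \<Phi>\<^sub>u \<Phi>\<^sub>y\<^sup>-\<^sup>1\<close> and \<open>p = \<phi>\<^sub>u - K \<phi>\<^sub>y\<close>.
\<close>
definition closed_loop ::
  "('t::{finite, linorder}, 'q::finite, 'm::finite) bmat \<Rightarrow> ('t, 'q, 'q) bmat \<Rightarrow> ('t, 'q) traj
    \<Rightarrow> ('t, 'q, 'm) resp \<Rightarrow> ('t, 'q, 'm) io \<Rightarrow> ('t, 'q) traj \<Rightarrow> ('t, 'q, 'm) io \<Rightarrow> bool" where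
  "closed_loop G \<Theta> y0 \<Phi> \<phi> e \<eta> \<longleftrightarrow>
     (let K = u_part \<Phi> ** matrix_inv (y_part \<Phi>); p = u_part \<phi> - K *v y_part \<phi> in
        y_part \<eta> = G *v u_part \<eta> + y0 + \<Theta> *v e \<and> u_part \<eta> = K *v y_part \<eta> + p)"

subsection \<open>Distributions and the Wasserstein ball\<close>

definition empirical :: "('k::finite \<Rightarrow> real ^ 'i::finite) \<Rightarrow> (real ^ 'i) measure" where
  "empirical \<xi> = measure_of UNIV (sets borel)
     (\<lambda>S. (\<Sum>k\<in>UNIV. emeasure (return borel (\<xi> k)) S) / of_nat CARD('k))"

lemma sets_empirical [simp, measurable_cong]: "sets (empirical \<xi>) = sets borel"
  unfolding empirical_def by (metis sets.sets_measure_of_eq space_borel)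

lemma emeasure_empirical:
  fixes \<xi> :: "'k::finite \<Rightarrow> real ^ 'i::finite"
  assumes "S \<in> sets borel"
  shows "emeasure (empirical \<xi>) S
    = (\<Sum>k\<in>UNIV. emeasure (return borel (\<xi> k)) S) / of_nat CARD('k)"
proof (rule emeasure_measure_of[OF empirical_def])
  show "countably_additive (sets (empirical \<xi>))
      (\<lambda>S. (\<Sum>k\<in>UNIV. emeasure (return borel (\<xi> k)) S) / of_nat CARD('k))"
  proof (rule countably_additiveI)
    fix F :: "nat \<Rightarrow> (real ^ 'i) set"
    assume F: "range F \<subseteq> sets (empirical \<xi>)" "disjoint_family F"
    have "(\<Sum>i. (\<Sum>k\<in>UNIV. emeasure (return borel (\<xi> k)) (F i)) / of_nat CARD('k))
      = (\<Sum>k\<in>UNIV. \<Sum>i. emeasure (return borel (\<xi> k)) (F i)) / of_nat CARD('k)"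
      by (simp add: divide_ennreal_def suminf_sum ennreal_suminf_multc)
    also have "\<dots> = (\<Sum>k\<in>UNIV. emeasure (return borel (\<xi> k)) (\<Union>i. F i)) / of_nat CARD('k)"
      using F by (auto simp: suminf_emeasure simp del: emeasure_return
        intro!: arg_cong[where f = "\<lambda>x. x / of_nat CARD('k)"] sum.cong)
    finally show "(\<Sum>i. (\<Sum>k\<in>UNIV. emeasure (return borel (\<xi> k)) (F i)) / of_nat CARD('k))
      = (\<Sum>k\<in>UNIV. emeasure (return borel (\<xi> k)) (\<Union>i. F i)) / of_nat CARD('k)" .
  qed
qed (use assms in \<open>auto simp: positive_def\<close>)

definition finite_mean_dists :: "(real ^ 'i::finite) measure set" where
  "finite_mean_dists =
     {Q. prob_space Q \<and> sets Q = sets borel \<and> (\<integral>\<^sup>+x. ennreal (norm1 x) \<partial>Q) < \<infinity>}"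

definition couplings ::
  "(real ^ 'i::finite) measure \<Rightarrow> (real ^ 'i) measure \<Rightarrow> ((real ^ 'i) \<times> (real ^ 'i)) measure set" where
  "couplings Q1 Q2 =
     {P. prob_space P \<and> sets P = sets (borel \<Otimes>\<^sub>M borel) \<and> distr P borel fst = Q1 \<and> distr P borel snd = Q2}"

definition wasserstein :: "(real ^ 'i::finite) measure \<Rightarrow> (real ^ 'i) measure \<Rightarrow> ereal" where
  "wasserstein Q1 Q2 =
     enn2ereal (INF P\<in>couplings Q1 Q2. \<integral>\<^sup>+z. ennreal (norm1 (fst z - snd z)) \<partial>P)"

definition wball :: "real \<Rightarrow> (real ^ 'i::finite) measure \<Rightarrow> (real ^ 'i) measure set" where
  "wball \<epsilon> Q0 = {Q \<in> finite_mean_dists. wasserstein Q Q0 \<le> ereal \<epsilon>}"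

definition worst_case ::
  "real \<Rightarrow> (real ^ 'i::finite) measure \<Rightarrow> (real ^ 'i \<Rightarrow> real) \<Rightarrow> ereal" where
  "worst_case \<epsilon> Q0 f = (SUP Q\<in>wball \<epsilon> Q0. ereal (\<integral>\<eta>. f \<eta> \<partial>Q))"

definition true_dist ::
  "('t::{finite, linorder}, 'q::finite, 'm::finite) bmat \<Rightarrow> ('t, 'q, 'q) bmat \<Rightarrow> ('t, 'q) traj
    \<Rightarrow> ('t, 'q) traj measure \<Rightarrow> ('t, 'q, 'm) resp \<Rightarrow> ('t, 'q, 'm) io
    \<Rightarrow> ('t, 'q, 'm) io measure" where
  "true_dist \<Delta> \<Theta> y0 Pe \<Phi> \<phi> = distr Pe borel (true_response \<Delta> \<Theta> y0 \<Phi> \<phi>)"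

definition nominal_dist ::
  "('t::{finite, linorder}, 'q::finite, 'q) bmat \<Rightarrow> ('t, 'q) traj \<Rightarrow> ('k::finite \<Rightarrow> ('t, 'q) traj)
    \<Rightarrow> ('t, 'q, 'm::finite) resp \<Rightarrow> ('t, 'q, 'm) io \<Rightarrow> ('t, 'q, 'm) io measure" where
  "nominal_dist \<Theta>h y0h es \<Phi> \<phi> = empirical (\<lambda>k. nominal_response \<Theta>h y0h \<Phi> \<phi> (es k))"

subsection \<open>The distributionally robust problem\<close>

text \<open>The achievability equation
  \<open>[I, -Gh] [\<Phi>\<^sub>y, \<phi>\<^sub>y; \<Phi>\<^sub>u, \<phi>\<^sub>u] = [I, 0]\<close>, by columns, with the causality structure.\<close>
definition achievable ::
  "('t::{finite, linorder}, 'q::finite, 'm::finite) bmat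
    \<Rightarrow> ('t, 'q, 'm) resp \<Rightarrow> ('t, 'q, 'm) io \<Rightarrow> bool" where
  "achievable Gh \<Phi> \<phi> \<longleftrightarrow>
     y_part \<Phi> - Gh ** u_part \<Phi> = mat 1 \<and>
     y_part \<phi> - Gh *v u_part \<phi> = 0 \<and>
     block_lower_tri (y_part \<Phi>) \<and> block_strictly_lower_tri (u_part \<Phi>)"

text \<open>
  The last three conjuncts say that the true response under the policy is well defined and equals
  \<open>true_response\<close>.
\<close>
definition dr_sls_feasible where
  "dr_sls_feasible \<epsilon> g G \<Theta> y0 Gh \<Theta>h y0h es \<Phi> \<phi> \<longleftrightarrow>
     worst_case \<epsilon> (nominal_dist \<Theta>h y0h es \<Phi> \<phi>) g \<le> 0 \<and>
     achievable Gh \<Phi> \<phi> \<and>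
     invertible (y_part \<Phi>) \<and>
     invertible (mat 1 - (G - Gh) ** u_part \<Phi>) \<and>
     (\<forall>e \<eta>. closed_loop G \<Theta> y0 \<Phi> \<phi> e \<eta> \<longleftrightarrow> \<eta> = true_response (G - Gh) \<Theta> y0 \<Phi> \<phi> e)"

definition dr_sls_cost where
  "dr_sls_cost \<epsilon> h \<Theta>h y0h es \<Phi> \<phi> = worst_case \<epsilon> (nominal_dist \<Theta>h y0h es \<Phi> \<phi>) h"

subsection \<open>The convex program\<close>

text \<open>Standard form: minimise \<open>f\<close> over \<open>{z \<in> E. \<forall>c\<in>C. c z \<le> 0}\<close>, where \<open>E\<close> is the solution set
  of the equality constraints.\<close>
definition convex_program ::
  "('z::real_vector \<Rightarrow> real) \<Rightarrow> ('z \<Rightarrow> real) set \<Rightarrow> 'z set \<Rightarrow> bool" where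
  "convex_program f C E \<longleftrightarrow> convex_on UNIV f \<and> (\<forall>c\<in>C. convex_on UNIV c) \<and> affine E"

definition program_feasible :: "('z \<Rightarrow> real) set \<Rightarrow> 'z set \<Rightarrow> 'z set" where
  "program_feasible C E = {z \<in> E. \<forall>c\<in>C. c z \<le> 0}"

text \<open>The decision variable is \<open>(\<epsilon>, \<Phi>, \<phi>, s, r)\<close>; \<open>r $ k\<close> is the epigraph variable of
  the constraint function \<open>g\<close>.\<close>
type_synonym ('t, 'q, 'm, 'k) decision =
  "real \<times> ('t, 'q, 'm) resp \<times> ('t, 'q, 'm) io \<times> (real ^ 'k) \<times> (real ^ 'k)"

definition relax_obj ::
  "real \<Rightarrow> ('t::{finite, linorder}, 'q::finite, 'm::finite, 'k::finite) decision \<Rightarrow> real" where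
  "relax_obj lh = (\<lambda>(\<epsilon>, \<Phi>, \<phi>, s, r). lh * \<epsilon> + 1 / real CARD('k) * (\<Sum>k\<in>UNIV. s $ k))"

definition relax_eqs ::
  "('t::{finite, linorder}, 'q::finite, 'm::finite) bmat
    \<Rightarrow> ('t, 'q, 'm, 'k::finite) decision set" where
  "relax_eqs Gh = {(\<epsilon>, \<Phi>, \<phi>, s, r). achievable Gh \<Phi> \<phi>}"

definition radius_bound ::
  "real \<Rightarrow> real \<Rightarrow> real \<Rightarrow> real \<Rightarrow> real \<Rightarrow> real
    \<Rightarrow> ('t::{finite, linorder}, 'q::finite, 'q) bmat \<Rightarrow> ('t, 'q) traj \<Rightarrow> ('k::finite \<Rightarrow> ('t, 'q) traj)
    \<Rightarrow> ('t, 'q, 'm::finite) resp \<Rightarrow> ('t, 'q, 'm) io \<Rightarrow> real" where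
  "radius_bound \<gamma>1 \<gamma>2 \<gamma>3 \<kappa> \<rho> \<sigma> \<Theta>h y0h es \<Phi> \<phi> =
     mnorm1 \<Phi> / (real CARD('k) * (1 - \<rho>))
       * ((\<Sum>k\<in>UNIV. \<rho> * norm1 (y0h + \<Theta>h *v es k) + \<gamma>2 * norm1 (es k)) + real CARD('k) * \<gamma>3)
     + (\<rho> / \<gamma>1 + \<sigma>) * (\<gamma>1 / (1 - \<rho>)) * norm1 (u_part \<phi>)
     + \<kappa> / (1 - \<rho>) * mnorm1 \<Phi> * (mnorm1 \<Theta>h + \<gamma>2)"

definition relax_ineqs ::
  "real \<Rightarrow> real \<Rightarrow> real \<Rightarrow> real \<Rightarrow> real \<Rightarrow> real \<Rightarrow> real
    \<Rightarrow> (('t, 'q, 'm) io \<Rightarrow> real) \<Rightarrow> (('t, 'q, 'm) io \<Rightarrow> real)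
    \<Rightarrow> ('t::{finite, linorder}, 'q::finite, 'q) bmat \<Rightarrow> ('t, 'q) traj \<Rightarrow> ('k::finite \<Rightarrow> ('t, 'q) traj)
    \<Rightarrow> (('t, 'q, 'm::finite, 'k) decision \<Rightarrow> real) set" where
  "relax_ineqs \<gamma>1 \<gamma>2 \<gamma>3 \<kappa> \<rho> \<sigma> lg h g \<Theta>h y0h es =
     (\<Union>k. {\<lambda>(\<epsilon>, \<Phi>, \<phi>, s, r). h (nominal_response \<Theta>h y0h \<Phi> \<phi> (es k)) - s $ k,
           \<lambda>(\<epsilon>, \<Phi>, \<phi>, s, r). g (nominal_response \<Theta>h y0h \<Phi> \<phi> (es k)) - r $ k})
     \<union> {\<lambda>(\<epsilon>, \<Phi>, \<phi>, s, r). lg * \<epsilon> + 1 / real CARD('k) * (\<Sum>k\<in>UNIV. r $ k),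
        \<lambda>(\<epsilon>, \<Phi>, \<phi>, s, r). radius_bound \<gamma>1 \<gamma>2 \<gamma>3 \<kappa> \<rho> \<sigma> \<Theta>h y0h es \<Phi> \<phi> - \<epsilon>,
        \<lambda>(\<epsilon>, \<Phi>, \<phi>, s, r). mnorm1 (y_part \<Phi>) - \<sigma>,
        \<lambda>(\<epsilon>, \<Phi>, \<phi>, s, r). \<gamma>1 * mnorm1 (u_part \<Phi>) - \<rho>}"

end

theory Submission imports Defs begin

text \<open>
  The bound \<open>\<gamma>1 \<parallel>\<Phi>\<^sub>u\<parallel> \<le> \<rho> < 1\<close> makes \<open>\<Delta> \<Phi>\<^sub>u\<close> a contraction, so \<open>R = (I - \<Delta> \<Phi>\<^sub>u)\<^sup>-\<^sup>1\<close> satisfies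
  \<open>\<parallel>R\<parallel> \<le> 1 / (1 - \<rho>)\<close> and \<open>\<parallel>R - I\<parallel> \<le> \<rho> / (1 - \<rho>)\<close>. The difference between the nominal response to
  \<open>e\<close> and the true response to \<open>e'\<close> therefore splits into \<open>\<Phi> R \<Theta> (e - e')\<close>, the model error at the common
  sample \<open>e\<close>, and \<open>\<Phi> R \<Delta> \<phi>\<^sub>u\<close>. Pushing a nearly optimal coupling of the empirical and the true innovation
  distribution forward through the two responses bounds the Wasserstein distance by the right-hand side
  of the constraint on the radius. On the ball, expectations of an \<open>l\<close>-Lipschitz function exceed the
  sample average by at most \<open>l\<close> times the radius, which gives the remaining guarantees. Causality makes
  \<open>\<Phi>\<^sub>y = I + Gh \<Phi>\<^sub>u\<close> the identity plus a strictly block-lower-triangular matrix, hence invertible.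
\<close>

subsection \<open>The 1-norm and the induced matrix norm\<close>

lemma norm1_nonneg [simp]: "0 \<le> norm1 x"
  by (simp add: norm1_def sum_nonneg)

lemma norm1_zero [simp]: "norm1 0 = 0"
  by (simp add: norm1_def)

lemma norm1_eq_0_iff [simp]: "norm1 x = 0 \<longleftrightarrow> x = 0"
  by (simp add: norm1_def sum_nonneg_eq_0_iff vec_eq_iff)

lemma norm1_triangle: "norm1 (x + y) \<le> norm1 x + norm1 y"
  by (simp add: norm1_def sum_mono flip: sum.distrib)

lemma norm1_scaleR: "norm1 (a *\<^sub>R x) = \<bar>a\<bar> * norm1 x"
  by (simp add: norm1_def abs_mult sum_distrib_left)

lemma norm1_minus_commute: "norm1 (x - y) = norm1 (y - x)"
  by (simp add: norm1_def abs_minus_commute)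

lemma norm1_le_norm: "norm1 (x :: real ^ 'i::finite) \<le> real CARD('i) * norm x"
  unfolding norm1_def using sum_bounded_above[of UNIV "\<lambda>i. \<bar>x $ i\<bar>" "norm x"]
  by (simp add: component_le_norm_cart)

lemma continuous_on_norm1 [continuous_intros]:
  "continuous_on S f \<Longrightarrow> continuous_on S (\<lambda>x. norm1 (f x))"
  unfolding norm1_def by (intro continuous_intros)

lemma borel_measurable_norm1 [measurable]: "norm1 \<in> borel_measurable borel"
  by (intro borel_measurable_continuous_onI continuous_intros)

text \<open>This additivity allows the output and input parts of a response to be bounded
  separately, by \<open>\<sigma>\<close> and \<open>\<rho> / \<gamma>1\<close>, with the two bounds
  simply adding up.\<close>

lemma norm1_parts:
  fixes v :: "real ^ ('i::finite + 'j::finite)"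
  shows "norm1 v = norm1 (y_part v) + norm1 (u_part v)"
proof -
  have "norm1 v = (\<Sum>i\<in>(UNIV :: 'i set) <+> (UNIV :: 'j set). \<bar>v $ i\<bar>)"
    by (simp add: norm1_def)
  also have "\<dots> = norm1 (y_part v) + norm1 (u_part v)"
    by (subst sum.Plus) (simp_all add: norm1_def y_part_def u_part_def)
  finally show ?thesis .
qed

lemma norm1_matrix_vector_le_sum:
  "norm1 (M *v x) \<le> (\<Sum>i\<in>UNIV. \<Sum>j\<in>UNIV. \<bar>M $ i $ j\<bar>) * norm1 x"
proof -
  have "\<bar>(M *v x) $ i\<bar> \<le> (\<Sum>j\<in>UNIV. \<bar>M $ i $ j\<bar>) * norm1 x" for i
  proof -
    have "\<bar>(M *v x) $ i\<bar> \<le> (\<Sum>j\<in>UNIV. \<bar>M $ i $ j\<bar> * \<bar>x $ j\<bar>)"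
      by (simp add: matrix_vector_mult_def sum_abs flip: abs_mult)
    also have "\<dots> \<le> (\<Sum>j\<in>UNIV. \<bar>M $ i $ j\<bar> * norm1 x)"
      unfolding norm1_def by (intro sum_mono mult_left_mono member_le_sum) auto
    finally show ?thesis by (simp add: sum_distrib_right)
  qed
  then show ?thesis
    unfolding norm1_def[of "M *v x"] sum_distrib_right by (intro sum_mono) (simp add: sum_distrib_right)
qed

text \<open>A real-valued \<open>SUP\<close> carries information only for a bounded set; the sum of
  all absolute entries is a crude but sufficient bound.\<close>

lemma bdd_above_norm1_quotients: "bdd_above (range (\<lambda>x. norm1 (M *v x) / norm1 x))"
proof (rule bdd_aboveI2)
  fix x
  show "norm1 (M *v x) / norm1 x \<le> (\<Sum>i\<in>UNIV. \<Sum>j\<in>UNIV. \<bar>M $ i $ j\<bar>)"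
    using norm1_matrix_vector_le_sum[of M x]
    by (cases "x = 0") (auto simp: divide_le_eq less_le sum_nonneg)
qed

lemma norm1_matrix_vector_le: "norm1 (M *v x) \<le> mnorm1 M * norm1 x"
proof (cases "x = 0")
  case False
  have "norm1 (M *v x) / norm1 x \<le> mnorm1 M"
    unfolding mnorm1_def by (rule cSUP_upper[OF UNIV_I bdd_above_norm1_quotients])
  then show ?thesis using False by (simp add: divide_le_eq less_le)
qed simp

lemma mnorm1_nonneg [simp]: "0 \<le> mnorm1 M"
  \<comment> \<open>The witness is the zero vector, where the quotient is
    \<open>0 / 0 = 0\<close>.\<close>
  unfolding mnorm1_def by (rule cSUP_upper2[OF bdd_above_norm1_quotients, of _ 0]) auto

lemma mnorm1_le:
  assumes "0 \<le> c" "\<And>x. norm1 (M *v x) \<le> c * norm1 x"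
  shows "mnorm1 M \<le> c"
  unfolding mnorm1_def
proof (rule cSUP_least)
  fix x show "norm1 (M *v x) / norm1 x \<le> c"
    using assms by (cases "x = 0") (auto simp: divide_le_eq less_le)
qed simp

lemma norm1_matrix_vector_le_trans: "mnorm1 M \<le> c \<Longrightarrow> norm1 x \<le> d \<Longrightarrow> norm1 (M *v x) \<le> c * d"
  by (rule order_trans[OF norm1_matrix_vector_le]) (auto intro: mult_mono order_trans[OF mnorm1_nonneg])

lemma mnorm1_triangle: "mnorm1 (M + N) \<le> mnorm1 M + mnorm1 N"
proof (rule mnorm1_le)
  fix x
  have "norm1 ((M + N) *v x) \<le> norm1 (M *v x) + norm1 (N *v x)"
    by (simp add: matrix_vector_mult_add_rdistrib norm1_triangle)
  also have "\<dots> \<le> (mnorm1 M + mnorm1 N) * norm1 x"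
    unfolding distrib_right by (intro add_mono norm1_matrix_vector_le)
  finally show "norm1 ((M + N) *v x) \<le> (mnorm1 M + mnorm1 N) * norm1 x" .
qed simp

lemma mnorm1_scaleR_le: "mnorm1 (a *\<^sub>R M) \<le> \<bar>a\<bar> * mnorm1 M"
proof (rule mnorm1_le)
  fix x
  show "norm1 ((a *\<^sub>R M) *v x) \<le> \<bar>a\<bar> * mnorm1 M * norm1 x"
    using norm1_matrix_vector_le[of M x]
    by (simp add: norm1_scaleR mult.assoc mult_left_mono flip: scaleR_matrix_vector_assoc)
qed simp

lemma convex_on_norm1: "convex_on UNIV norm1"
proof (rule convex_onI)
  fix t :: real and x y :: "real ^ 'i"
  assume "0 < t" "t < 1"
  then show "norm1 ((1 - t) *\<^sub>R x + t *\<^sub>R y) \<le> (1 - t) * norm1 x + t * norm1 y"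
    using norm1_triangle[of "(1 - t) *\<^sub>R x" "t *\<^sub>R y"] by (simp add: norm1_scaleR)
qed simp

lemma convex_on_mnorm1: "convex_on UNIV mnorm1"
proof (rule convex_onI)
  fix t :: real and M N :: "real ^ 'i ^ 'j"
  assume "0 < t" "t < 1"
  then show "mnorm1 ((1 - t) *\<^sub>R M + t *\<^sub>R N) \<le> (1 - t) * mnorm1 M + t * mnorm1 N"
    using mnorm1_triangle[of "(1 - t) *\<^sub>R M" "t *\<^sub>R N"] mnorm1_scaleR_le[of "1 - t" M]
      mnorm1_scaleR_le[of t N] by simp
qed simp

section \<open>Continuity and measurability of Lipschitz functions\<close>

lemma continuous_on_lipschitz1:
  assumes "lipschitz1 l f" shows "continuous_on S f"
proof (rule lipschitz_on_continuous_on)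
  \<comment> \<open>\<open>lipschitz_on\<close> refers to the Euclidean distance; comparing it with
    \<open>norm1\<close> costs the factor \<open>CARD('a)\<close>.\<close>
  show "(l * real CARD('a))-lipschitz_on S (f :: real ^ 'a::finite \<Rightarrow> real)"
  proof (rule lipschitz_onI)
    fix x y :: "real ^ 'a"
    have "dist (f x) (f y) \<le> l * norm1 (x - y)" "0 \<le> l"
      using assms by (auto simp: lipschitz1_def dist_real_def)
    moreover have "l * norm1 (x - y) \<le> l * (real CARD('a) * dist x y)"
      using \<open>0 \<le> l\<close> norm1_le_norm[of "x - y"] by (intro mult_left_mono) (auto simp: dist_norm)
    ultimately show "dist (f x) (f y) \<le> l * real CARD('a) * dist x y" by (simp add: mult.assoc)
  qed (use assms in \<open>simp add: lipschitz1_def\<close>)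
qed

lemma borel_measurable_lipschitz1: "lipschitz1 l f \<Longrightarrow> f \<in> borel_measurable borel"
  by (intro borel_measurable_continuous_onI continuous_on_lipschitz1)

subsection \<open>Block matrices\<close>

lemma y_part_add [simp]: "y_part (v + w) = y_part v + y_part w"
  and u_part_add [simp]: "u_part (v + w) = u_part v + u_part w"
  and y_part_scaleR [simp]: "y_part (a *\<^sub>R x) = a *\<^sub>R y_part x"
  and u_part_scaleR [simp]: "u_part (a *\<^sub>R x) = a *\<^sub>R u_part x"
  by (simp_all add: y_part_def u_part_def vec_eq_iff)

lemma y_part_mult [simp]: "y_part (M *v x) = y_part M *v x"
  and u_part_mult [simp]: "u_part (M *v x) = u_part M *v x"
  by (simp_all add: y_part_def u_part_def vec_eq_iff matrix_vector_mult_def)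

lemma parts_eq_iff: "v = w \<longleftrightarrow> y_part v = y_part w \<and> u_part v = u_part w"
proof
  assume parts: "y_part v = y_part w \<and> u_part v = u_part w"
  have "v $ i = w $ i" for i
    using parts by (cases i) (auto simp: y_part_def u_part_def vec_eq_iff)
  then show "v = w" by (simp add: vec_eq_iff)
qed simp

lemma block2x2_mult_parts:
  "y_part (block2x2 A B C D *v v) = A *v y_part v + B *v u_part v"
  "u_part (block2x2 A B C D *v v) = C *v y_part v + D *v u_part v"
  unfolding y_part_def u_part_def block2x2_def matrix_vector_mult_def
  by (simp_all add: vec_eq_iff UNIV_Plus_UNIV[symmetric] sum.Plus del: UNIV_Plus_UNIV)

section \<open>Kernels, inverses and the resolvent\<close>

lemma invertible_iff_kernel:
  fixes M :: "real ^ 'n ^ 'n"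
  shows "invertible M \<longleftrightarrow> (\<forall>x. M *v x = 0 \<longrightarrow> x = 0)"
  by (simp add: invertible_left_inverse matrix_left_invertible_ker)

text \<open>\<open>matrix_inv\<close> is a choice among two-sided inverses, so the existence of one
  yields both equations.\<close>

lemma matrix_inv_mult_vector:
  fixes M :: "real ^ 'n ^ 'n"
  assumes "invertible M"
  shows "M *v (matrix_inv M *v x) = x" "matrix_inv M *v (M *v x) = x"
proof -
  have "M ** matrix_inv M = mat 1 \<and> matrix_inv M ** M = mat 1"
    unfolding matrix_inv_def by (rule someI_ex) (use assms in \<open>simp add: invertible_def\<close>)
  then show "M *v (matrix_inv M *v x) = x" "matrix_inv M *v (M *v x) = x"
    by (simp_all add: matrix_vector_mul_assoc)
qed

text \<open>In every term \<open>M $ i $ k * N $ k $ j\<close> a factor vanishes: the first if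
  \<open>k\<close> is later than \<open>i\<close>, the second if \<open>k\<close> is no later than
  \<open>i\<close> and hence no later than \<open>j\<close>.\<close>

lemma block_lower_tri_mult_strict:
  fixes M :: "('t::{finite, linorder}, 'a::finite, 'b::finite) bmat"
    and N :: "('t, 'b, 'c::finite) bmat"
  assumes "block_lower_tri M" "block_strictly_lower_tri N"
  shows "block_strictly_lower_tri (M ** N)"
  unfolding block_strictly_lower_tri_def
proof (intro allI impI)
  fix i :: "'t \<times> 'a" and j :: "'t \<times> 'c"
  assume "fst i \<le> fst j"
  have zero: "M $ i $ k * N $ k $ j = 0" for k
  proof (cases "fst i < fst k")
    case True
    then have "M $ i $ k = 0" using assms(1) unfolding block_lower_tri_def by blast
    then show ?thesis by simp
  next
    case False
    then have "fst k \<le> fst j" using \<open>fst i \<le> fst j\<close> by simp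
    then have "N $ k $ j = 0" using assms(2) unfolding block_strictly_lower_tri_def by blast
    then show ?thesis by simp
  qed
  show "(M ** N) $ i $ j = 0"
    unfolding matrix_matrix_mult_def by (simp only: vec_lambda_beta zero sum.neutral_const)
qed

text \<open>Forward substitution: in \<open>(mat 1 + N) *v x = 0\<close> the components at time
  \<open>t\<close> are determined by those at earlier times, so all vanish in turn.\<close>

lemma invertible_one_plus_strictly_lower:
  fixes N :: "('t::{finite, linorder}, 'a::finite, 'a) bmat"
  assumes N: "block_strictly_lower_tri N"
  shows "invertible (mat 1 + N)"
  unfolding invertible_iff_kernel
proof (intro allI impI)
  fix x assume "(mat 1 + N) *v x = 0"
  then have "x + N *v x = 0" by (simp add: matrix_vector_mult_add_rdistrib)
  then have "x $ i + (N *v x) $ i = 0" for i by (metis vector_add_component zero_index)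
  then have x: "x $ i + (\<Sum>j\<in>UNIV. N $ i $ j * x $ j) = 0" for i
    by (simp only: matrix_vector_mult_def vec_lambda_beta)
  have "x $ (t, c) = 0" for t c
  \<comment> \<open>The measure is the number of earlier times, that is, the position of
    \<open>t\<close> in the finite order.\<close>
  proof (induction "card {s. s < t}" arbitrary: t c rule: less_induct)
    case less
    have zero: "N $ (t, c) $ j * x $ j = 0" for j
    proof (cases "fst j < t")
      case True
      then have "card {s. s < fst j} < card {s. s < t}"
        by (intro psubset_card_mono) auto
      then have "x $ (fst j, snd j) = 0" by (rule less)
      then show ?thesis by simp
    next
      case False
      then have "N $ (t, c) $ j = 0"
        using N unfolding block_strictly_lower_tri_def by (metis fst_conv not_less)
      then show ?thesis by simp
    qed
    show ?case
      using x[of "(t, c)"] by (simp only: zero sum.neutral_const add_0_right)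
  qed
  then show "x = 0" by (simp add: vec_eq_iff)
qed

text \<open>A kernel vector is a fixed point of \<open>M\<close>, and a contraction fixes only
  \<open>0\<close>.\<close>

lemma invertible_one_minus_contraction:
  fixes M :: "real ^ 'n::finite ^ 'n"
  assumes "\<rho> < 1" "\<And>x. norm1 (M *v x) \<le> \<rho> * norm1 x"
  shows "invertible (mat 1 - M)"
  unfolding invertible_iff_kernel
proof (intro allI impI)
  fix x assume "(mat 1 - M) *v x = 0"
  then have "M *v x = x" by (simp add: matrix_vector_mult_diff_rdistrib)
  then have "(1 - \<rho>) * norm1 x \<le> 0" using assms(2)[of x] by (simp add: algebra_simps)
  then have "norm1 x \<le> 0" using assms(1) by (simp add: mult_le_0_iff)
  then show "x = 0" using norm1_nonneg[of x] by (simp add: antisym flip: norm1_eq_0_iff)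
qed

text \<open>Both bounds come from the identity \<open>R *v v = v + M *v (R *v v)\<close>: taking
  norms and absorbing the last term gives the first, and the second bounds that last term by the
  first.\<close>

lemma norm1_resolvent_bounds:
  fixes M :: "real ^ 'n::finite ^ 'n"
  assumes "0 \<le> \<rho>" "\<rho> < 1" and contraction: "\<And>x. norm1 (M *v x) \<le> \<rho> * norm1 x"
  defines "R \<equiv> matrix_inv (mat 1 - M)"
  shows "norm1 (R *v v) \<le> norm1 v / (1 - \<rho>)"
    and "norm1 (R *v v - v) \<le> \<rho> * norm1 v / (1 - \<rho>)"
proof -
  have "(mat 1 - M) *v (R *v v) = v"
    unfolding R_def
    by (rule matrix_inv_mult_vector(1)[OF invertible_one_minus_contraction[OF assms(2,3)]])
  then have eq: "R *v v = v + M *v (R *v v)"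
    by (simp add: matrix_vector_mult_diff_rdistrib algebra_simps)
  have "norm1 (R *v v) \<le> norm1 v + \<rho> * norm1 (R *v v)"
    by (subst eq) (rule order_trans[OF norm1_triangle add_left_mono[OF contraction]])
  then show bound: "norm1 (R *v v) \<le> norm1 v / (1 - \<rho>)"
    using assms(2) by (simp add: field_simps)
  have "norm1 (R *v v - v) = norm1 (M *v (R *v v))"
    by (subst eq) simp
  also have "\<dots> \<le> \<rho> * (norm1 v / (1 - \<rho>))"
    by (rule order_trans[OF contraction mult_left_mono[OF bound \<open>0 \<le> \<rho>\<close>]])
  finally show "norm1 (R *v v - v) \<le> \<rho> * norm1 v / (1 - \<rho>)" by simp
qed

subsection \<open>Closed-loop responses\<close>

text \<open>Both block rows apply their part of \<open>\<Phi>\<close> to the same vector, so the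
  block matrix amounts to one correction of \<open>\<phi>\<close> through
  \<open>\<Phi>\<close>.\<close>

lemma R_phi_mult:
  "R_phi \<Delta> \<Phi> *v \<phi> = \<phi> + \<Phi> *v (R_Phi \<Delta> \<Phi> *v (\<Delta> *v u_part \<phi>))"
  unfolding parts_eq_iff R_phi_def y_part_add u_part_add block2x2_mult_parts
  unfolding y_part_mult u_part_mult matrix_vector_mult_add_rdistrib matrix_vector_mul_lid
    matrix_vector_mult_0 add_0_left matrix_vector_mul_assoc[symmetric] by simp

text \<open>In this form the model error \<open>\<Delta> *v u_part \<phi>\<close> enters as one more
  disturbance beside \<open>y0 + \<Theta> *v e\<close>.\<close>

lemma true_response_eq:
  "true_response \<Delta> \<Theta> y0 \<Phi> \<phi> e = \<phi> + \<Phi> *v (R_Phi \<Delta> \<Phi> *v (y0 + \<Theta> *v e + \<Delta> *v u_part \<phi>))"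
  unfolding true_response_def R_phi_mult
  by (simp add: matrix_vector_right_distrib flip: matrix_vector_mul_assoc)

text \<open>The substitution \<open>y = \<phi>\<^sub>y + \<Phi>\<^sub>y z\<close> turns the policy into \<open>u = \<phi>\<^sub>u + \<Phi>\<^sub>u z\<close>, and achievability turns the
  system equation into \<open>(I - \<Delta> \<Phi>\<^sub>u) z = y0 + \<Theta> e + \<Delta> \<phi>\<^sub>u\<close>.\<close>
lemma closed_loop_iff_true_response:
  fixes G Gh :: "('t::{finite, linorder}, 'q::finite, 'm::finite) bmat"
  assumes ach: "achievable Gh \<Phi> \<phi>"
    and inv_y: "invertible (y_part \<Phi>)"
    and inv_R: "invertible (mat 1 - (G - Gh) ** u_part \<Phi>)"
  shows "closed_loop G \<Theta> y0 \<Phi> \<phi> e \<eta> \<longleftrightarrow> \<eta> = true_response (G - Gh) \<Theta> y0 \<Phi> \<phi> e"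
proof -
  define \<Delta> where "\<Delta> = G - Gh"
  define w where "w = y0 + \<Theta> *v e + \<Delta> *v u_part \<phi>"
  \<comment> \<open>\<open>z\<close> is the disturbance that the policy reconstructs from the
    output; it is defined for arbitrary \<open>\<eta>\<close>, so both directions can be argued in
    terms of it.\<close>
  define z where "z = matrix_inv (y_part \<Phi>) *v (y_part \<eta> - y_part \<phi>)"
  have y: "y_part \<eta> = y_part \<phi> + y_part \<Phi> *v z"
    unfolding z_def matrix_inv_mult_vector(1)[OF inv_y] by simp
  have z_eqI: "z = x" if "y_part \<eta> = y_part \<phi> + y_part \<Phi> *v x" for x
    unfolding z_def that add_diff_cancel_left' by (rule matrix_inv_mult_vector(2)[OF inv_y])
  have \<phi>: "y_part \<phi> = Gh *v u_part \<phi>" and "y_part \<Phi> = mat 1 + Gh ** u_part \<Phi>"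
    using ach by (simp_all add: achievable_def algebra_simps)
  then have \<Phi>: "y_part \<Phi> *v x = x + Gh *v (u_part \<Phi> *v x)" for x
    by (simp add: matrix_vector_mult_add_rdistrib matrix_vector_mul_assoc)
  define K where "K = u_part \<Phi> ** matrix_inv (y_part \<Phi>)"
  have "K *v y_part \<eta> + (u_part \<phi> - K *v y_part \<phi>) = u_part \<phi> + K *v (y_part \<eta> - y_part \<phi>)"
    by (simp add: matrix_vector_mult_diff_distrib)
  also have "K *v (y_part \<eta> - y_part \<phi>) = u_part \<Phi> *v z"
    by (simp add: K_def z_def matrix_vector_mul_assoc)
  finally have "closed_loop G \<Theta> y0 \<Phi> \<phi> e \<eta> \<longleftrightarrow>
      y_part \<eta> = G *v u_part \<eta> + y0 + \<Theta> *v e \<and> u_part \<eta> = u_part \<phi> + u_part \<Phi> *v z"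
    by (simp only: closed_loop_def Let_def flip: K_def)
  \<comment> \<open>The input equation is common to both sides and may be used to rewrite the output
    equation, hence \<open>rev_conj_cong\<close>.\<close>
  also have "\<dots> \<longleftrightarrow> (mat 1 - \<Delta> ** u_part \<Phi>) *v z = w \<and> u_part \<eta> = u_part \<phi> + u_part \<Phi> *v z"
  proof (rule rev_conj_cong[OF refl])
    assume "u_part \<eta> = u_part \<phi> + u_part \<Phi> *v z"
    then have "y_part \<eta> - (G *v u_part \<eta> + y0 + \<Theta> *v e) = (mat 1 - \<Delta> ** u_part \<Phi>) *v z - w"
      unfolding y \<phi> \<Phi> w_def \<Delta>_def
      by (simp add: matrix_vector_right_distrib matrix_vector_mult_diff_rdistrib
          flip: matrix_vector_mul_assoc)
    then show "y_part \<eta> = G *v u_part \<eta> + y0 + \<Theta> *v e \<longleftrightarrow> (mat 1 - \<Delta> ** u_part \<Phi>) *v z = w"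
      by (metis eq_iff_diff_eq_0)
  qed
  also have "(mat 1 - \<Delta> ** u_part \<Phi>) *v z = w \<longleftrightarrow> z = R_Phi \<Delta> \<Phi> *v w"
    unfolding R_Phi_def using matrix_inv_mult_vector[OF inv_R] by (metis \<Delta>_def)
  also have "z = R_Phi \<Delta> \<Phi> *v w \<and> u_part \<eta> = u_part \<phi> + u_part \<Phi> *v z
      \<longleftrightarrow> \<eta> = true_response \<Delta> \<Theta> y0 \<Phi> \<phi> e"
  proof (cases "z = R_Phi \<Delta> \<Phi> *v w")
    case True
    then show ?thesis using y by (simp add: parts_eq_iff[of \<eta>] true_response_eq w_def)
  next
    case False
    \<comment> \<open>\<open>y_part \<Phi>\<close> is injective, so a different \<open>z\<close>
      already means a different output.\<close>
    then have "y_part \<eta> \<noteq> y_part \<phi> + y_part \<Phi> *v (R_Phi \<Delta> \<Phi> *v w)" using z_eqI by blast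
    then show ?thesis using False by (simp add: parts_eq_iff[of \<eta>] true_response_eq w_def)
  qed
  finally show ?thesis by (simp only: \<Delta>_def)
qed

section \<open>Deviation of the true from the nominal response\<close>

lemma contraction_model_error:
  assumes \<Delta>: "mnorm1 \<Delta> \<le> \<gamma>" and \<Phi>u: "\<gamma> * mnorm1 \<Phi>u \<le> \<rho>"
  shows "norm1 ((\<Delta> ** \<Phi>u) *v x) \<le> \<rho> * norm1 x"
proof -
  have "norm1 ((\<Delta> ** \<Phi>u) *v x) \<le> \<gamma> * (mnorm1 \<Phi>u * norm1 x)"
    by (simp add: norm1_matrix_vector_le_trans[OF \<Delta> norm1_matrix_vector_le] flip: matrix_vector_mul_assoc)
  also have "\<dots> \<le> \<rho> * norm1 x"
    using mult_right_mono[OF \<Phi>u norm1_nonneg[of x]] by (simp add: mult.assoc)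
  finally show ?thesis .
qed

text \<open>The two responses take different innovations because they will be evaluated at the two
  coordinates of a coupling. On the right, \<open>e'\<close> occurs only in
  \<open>norm1 (e - e')\<close>; the rest depends on \<open>e\<close> alone and can be averaged over
  the samples.\<close>

lemma response_deviation:
  fixes \<Delta> :: "('t::{finite, linorder}, 'q::finite, 'm::finite) bmat" and \<Phi> :: "('t, 'q, 'm) resp"
    and \<Theta> \<Theta>h :: "('t, 'q, 'q) bmat"
  assumes rho: "0 \<le> \<rho>" "\<rho> < 1" and "\<gamma>1 > 0"
    and err: "mnorm1 \<Delta> \<le> \<gamma>1" "mnorm1 (\<Theta> - \<Theta>h) \<le> \<gamma>2" "norm1 (y0 - y0h) \<le> \<gamma>3"
    and bounds: "mnorm1 (y_part \<Phi>) \<le> \<sigma>" "\<gamma>1 * mnorm1 (u_part \<Phi>) \<le> \<rho>"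
  shows "norm1 (nominal_response \<Theta>h y0h \<Phi> \<phi> e - true_response \<Delta> \<Theta> y0 \<Phi> \<phi> e')
    \<le> mnorm1 \<Phi> * (mnorm1 \<Theta>h + \<gamma>2) / (1 - \<rho>) * norm1 (e - e')
      + (mnorm1 \<Phi> / (1 - \<rho>) * (\<rho> * norm1 (y0h + \<Theta>h *v e) + \<gamma>2 * norm1 e + \<gamma>3)
        + (\<rho> / \<gamma>1 + \<sigma>) * (\<gamma>1 / (1 - \<rho>)) * norm1 (u_part \<phi>))"
proof -
  define R where "R = R_Phi \<Delta> \<Phi>"
  define wh where "wh = y0h + \<Theta>h *v e"
  \<comment> \<open>Chosen so that \<open>wh + d = y0 + \<Theta> *v e\<close>: \<open>wh\<close> is
    the nominal disturbance at \<open>e\<close> and \<open>d\<close> its model error.\<close>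
  define d where "d = (y0 - y0h) + (\<Theta> - \<Theta>h) *v e"
  note contraction = contraction_model_error[OF err(1) bounds(2)]
  note R = norm1_resolvent_bounds[OF rho contraction, folded R_Phi_def, folded R_def]
  have \<Theta>: "mnorm1 \<Theta> \<le> mnorm1 \<Theta>h + \<gamma>2"
    using mnorm1_triangle[of \<Theta>h "\<Theta> - \<Theta>h"] err(2) by simp
  have split: "nominal_response \<Theta>h y0h \<Phi> \<phi> e - true_response \<Delta> \<Theta> y0 \<Phi> \<phi> e'
      = \<Phi> *v (R *v (\<Theta> *v (e - e'))) - \<Phi> *v ((R *v wh - wh) + R *v d) - \<Phi> *v (R *v (\<Delta> *v u_part \<phi>))"
    by (simp add: nominal_response_def true_response_eq R_def wh_def d_def algebra_simps)
  have "norm1 (R *v (\<Theta> *v (e - e'))) \<le> (mnorm1 \<Theta>h + \<gamma>2) * norm1 (e - e') / (1 - \<rho>)"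
    using rho by (intro order_trans[OF R(1)] divide_right_mono norm1_matrix_vector_le_trans[OF \<Theta>]) auto
  then have A: "norm1 (\<Phi> *v (R *v (\<Theta> *v (e - e'))))
      \<le> mnorm1 \<Phi> * ((mnorm1 \<Theta>h + \<gamma>2) * norm1 (e - e') / (1 - \<rho>))"
    by (rule norm1_matrix_vector_le_trans[OF order_refl])
  have "norm1 d \<le> \<gamma>3 + \<gamma>2 * norm1 e"
    unfolding d_def
    by (intro order_trans[OF norm1_triangle] add_mono err norm1_matrix_vector_le_trans[OF err(2)]) simp
  then have "norm1 (R *v d) \<le> (\<gamma>3 + \<gamma>2 * norm1 e) / (1 - \<rho>)"
    using rho by (intro order_trans[OF R(1)] divide_right_mono) auto
  then have "norm1 ((R *v wh - wh) + R *v d) \<le> \<rho> * norm1 wh / (1 - \<rho>) + (\<gamma>3 + \<gamma>2 * norm1 e) / (1 - \<rho>)"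
    by (intro order_trans[OF norm1_triangle] add_mono R(2))
  then have B: "norm1 (\<Phi> *v ((R *v wh - wh) + R *v d))
      \<le> mnorm1 \<Phi> * (\<rho> * norm1 wh / (1 - \<rho>) + (\<gamma>3 + \<gamma>2 * norm1 e) / (1 - \<rho>))"
    by (rule norm1_matrix_vector_le_trans[OF order_refl])
  define v where "v = R *v (\<Delta> *v u_part \<phi>)"
  have v: "norm1 v \<le> \<gamma>1 * norm1 (u_part \<phi>) / (1 - \<rho>)"
    unfolding v_def
    using rho by (intro order_trans[OF R(1)] divide_right_mono norm1_matrix_vector_le_trans[OF err(1)]) auto
  have "mnorm1 (u_part \<Phi>) \<le> \<rho> / \<gamma>1"
    using bounds(2) \<open>\<gamma>1 > 0\<close> by (simp add: field_simps)
  \<comment> \<open>Here the separate bounds on the two parts of \<open>\<Phi>\<close> replace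
    \<open>mnorm1 \<Phi>\<close>; this avoids a product of norms of decision variables and produces
    the factor \<open>\<rho> / \<gamma>1 + \<sigma>\<close>.\<close>
  then have "norm1 (\<Phi> *v v) \<le> \<sigma> * (\<gamma>1 * norm1 (u_part \<phi>) / (1 - \<rho>))
      + \<rho> / \<gamma>1 * (\<gamma>1 * norm1 (u_part \<phi>) / (1 - \<rho>))"
    unfolding norm1_parts[of "\<Phi> *v v"] y_part_mult u_part_mult
    by (intro add_mono norm1_matrix_vector_le_trans bounds v)
  then have C: "norm1 (\<Phi> *v (R *v (\<Delta> *v u_part \<phi>)))
      \<le> (\<rho> / \<gamma>1 + \<sigma>) * (\<gamma>1 / (1 - \<rho>)) * norm1 (u_part \<phi>)"
    using \<open>\<gamma>1 > 0\<close> by (simp add: v_def algebra_simps add_divide_distrib)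
  have diff: "norm1 (a - b) \<le> norm1 a + norm1 b" for a b :: "('t, 'q, 'm) io"
    using norm1_triangle[of a "- b"] norm1_minus_commute[of 0 b] by simp
  have "norm1 (nominal_response \<Theta>h y0h \<Phi> \<phi> e - true_response \<Delta> \<Theta> y0 \<Phi> \<phi> e')
      \<le> mnorm1 \<Phi> * ((mnorm1 \<Theta>h + \<gamma>2) * norm1 (e - e') / (1 - \<rho>))
        + mnorm1 \<Phi> * (\<rho> * norm1 wh / (1 - \<rho>) + (\<gamma>3 + \<gamma>2 * norm1 e) / (1 - \<rho>))
        + (\<rho> / \<gamma>1 + \<sigma>) * (\<gamma>1 / (1 - \<rho>)) * norm1 (u_part \<phi>)"
    unfolding split by (intro order_trans[OF diff] add_mono A B C)
  also have "\<dots> = mnorm1 \<Phi> * (mnorm1 \<Theta>h + \<gamma>2) / (1 - \<rho>) * norm1 (e - e')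
      + (mnorm1 \<Phi> / (1 - \<rho>) * (\<rho> * norm1 wh + \<gamma>2 * norm1 e + \<gamma>3)
        + (\<rho> / \<gamma>1 + \<sigma>) * (\<gamma>1 / (1 - \<rho>)) * norm1 (u_part \<phi>))"
    by (simp add: algebra_simps add_divide_distrib)
  finally show ?thesis by (simp only: wh_def)
qed

subsection \<open>Empirical distributions and couplings\<close>

text \<open>As the image of the uniform distribution on the sample indices, the empirical measure
  has finite averages as its integrals.\<close>

lemma empirical_eq_distr:
  "empirical (\<xi> :: 'k::finite \<Rightarrow> real ^ 'i::finite) = distr (measure_pmf (pmf_of_set UNIV)) borel \<xi>"
proof (rule measure_eqI)
  fix S assume "S \<in> sets (empirical \<xi>)"
  then have S: "S \<in> sets borel" by simp
  \<comment> \<open>Indices are counted rather than values, so repeated samples keep their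
    multiplicity.\<close>
  have "(\<Sum>k\<in>UNIV. emeasure (return borel (\<xi> k)) S) = of_nat (card (\<xi> -` S))"
    using S by (simp add: indicator_def of_bool_def sum.If_cases vimage_def)
  then show "emeasure (empirical \<xi>) S = emeasure (distr (measure_pmf (pmf_of_set UNIV)) borel \<xi>) S"
    using S by (simp add: emeasure_empirical emeasure_distr emeasure_pmf_of_set
        divide_ennreal[symmetric] ennreal_of_nat_eq_real_of_nat)
qed simp

lemma nn_integral_empirical:
  fixes \<xi> :: "'k::finite \<Rightarrow> real ^ 'i::finite"
  assumes [measurable]: "f \<in> borel_measurable borel" and "\<And>x. 0 \<le> f x"
  shows "(\<integral>\<^sup>+x. ennreal (f x) \<partial>empirical \<xi>) = ennreal ((\<Sum>k\<in>UNIV. f (\<xi> k)) / real CARD('k))"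
  using assms(2)
  by (simp add: empirical_eq_distr nn_integral_distr nn_integral_pmf_of_set sum_nonneg
      divide_ennreal[symmetric] ennreal_of_nat_eq_real_of_nat)

lemma integral_empirical:
  fixes \<xi> :: "'k::finite \<Rightarrow> real ^ 'i::finite" and f :: "real ^ 'i \<Rightarrow> real"
  assumes [measurable]: "f \<in> borel_measurable borel"
  shows "(\<integral>x. f x \<partial>empirical \<xi>) = (\<Sum>k\<in>UNIV. f (\<xi> k)) / real CARD('k)"
    and "integrable (empirical \<xi>) f"
  by (auto simp: empirical_eq_distr integral_distr integrable_distr_eq integral_pmf_of_set
      intro!: integrable_measure_pmf_finite)

lemma empirical_comp:
  assumes [measurable]: "f \<in> borel_measurable borel"
  shows "distr (empirical \<xi>) borel f = empirical (\<lambda>k. f (\<xi> k))"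
  by (simp add: empirical_eq_distr distr_distr comp_def)

section \<open>Transport bounds from couplings\<close>

lemma wasserstein_le_iff:
  assumes "0 \<le> c"
  shows "wasserstein Q1 Q2 \<le> ereal c \<longleftrightarrow>
    (INF P\<in>couplings Q1 Q2. \<integral>\<^sup>+z. ennreal (norm1 (fst z - snd z)) \<partial>P) \<le> ennreal c"
  \<comment> \<open>For \<open>0 \<le> c\<close> the two comparisons agree; a negative
    \<open>c\<close> would be truncated to \<open>0\<close> by \<open>ennreal\<close>.\<close>
  unfolding wasserstein_def less_eq_ennreal.rep_eq enn2ereal_ennreal[OF assms] ..

lemma wasserstein_nonneg: "0 \<le> wasserstein Q1 Q2"
  unfolding wasserstein_def by simp

text \<open>The slack \<open>\<delta>\<close> stands in for attainment of the infimum: a value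
  strictly above the infimum is undercut by some coupling.\<close>

lemma near_optimal_coupling:
  assumes "wasserstein Q1 Q2 \<le> ereal c" "0 < \<delta>"
  obtains P where "P \<in> couplings Q1 Q2"
    "(\<integral>\<^sup>+z. ennreal (norm1 (fst z - snd z)) \<partial>P) \<le> ennreal (c + \<delta>)"
proof -
  have "0 \<le> c" using order_trans[OF wasserstein_nonneg assms(1)] by simp
  have "ennreal c < ennreal (c + \<delta>)" using \<open>0 \<le> c\<close> \<open>0 < \<delta>\<close> by (simp add: ennreal_lessI)
  then have "(INF P\<in>couplings Q1 Q2. \<integral>\<^sup>+z. ennreal (norm1 (fst z - snd z)) \<partial>P) < ennreal (c + \<delta>)"
    using assms(1) \<open>0 \<le> c\<close> by (auto simp: wasserstein_le_iff intro: le_less_trans)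
  then show ?thesis using that by (auto simp: INF_less_iff intro: less_imp_le)
qed

lemma distr_coupling:
  fixes P :: "((real ^ 'i::finite) \<times> (real ^ 'i)) measure" and a b :: "real ^ 'i \<Rightarrow> real ^ 'j::finite"
  assumes P: "P \<in> couplings Q1 Q2"
    and [measurable]: "a \<in> borel_measurable borel" "b \<in> borel_measurable borel"
  shows "distr P (borel \<Otimes>\<^sub>M borel) (\<lambda>z. (a (fst z), b (snd z))) \<in> couplings (distr Q1 borel a) (distr Q2 borel b)"
proof -
  interpret prob_space P using P by (simp add: couplings_def)
  have [measurable_cong]: "sets P = sets (borel \<Otimes>\<^sub>M borel)" using P by (simp add: couplings_def)
  have "distr P borel fst = Q1" "distr P borel snd = Q2" using P by (auto simp: couplings_def)
  then show ?thesis
    by (auto simp: couplings_def distr_distr comp_def intro!: prob_space_distr)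
qed

text \<open>The pushed-forward coupling is a candidate for the new infimum. The remainder
  \<open>c\<close> depends on the first coordinate only, so it integrates to \<open>m\<close> under
  every coupling.\<close>

lemma wasserstein_distr_le:
  fixes Q1 Q2 :: "(real ^ 'i::finite) measure" and a b :: "real ^ 'i \<Rightarrow> real ^ 'j::finite"
  assumes W: "wasserstein Q1 Q2 \<le> ereal \<kappa>"
    and [measurable]: "a \<in> borel_measurable borel" "b \<in> borel_measurable borel" "c \<in> borel_measurable borel"
    and "0 \<le> K" "\<And>x. 0 \<le> c x"
    and le: "\<And>x y. norm1 (a x - b y) \<le> K * norm1 (x - y) + c x"
    and c: "(\<integral>\<^sup>+x. ennreal (c x) \<partial>Q1) = ennreal m" "0 \<le> m"
  shows "wasserstein (distr Q1 borel a) (distr Q2 borel b) \<le> ereal (K * \<kappa> + m)"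
proof -
  have "0 \<le> \<kappa>" using order_trans[OF wasserstein_nonneg W] by simp
  have "(INF P\<in>couplings (distr Q1 borel a) (distr Q2 borel b). \<integral>\<^sup>+z. ennreal (norm1 (fst z - snd z)) \<partial>P)
      \<le> ennreal (K * \<kappa> + m)" (is "?I \<le> _")
  proof (rule ennreal_le_epsilon)
    fix \<epsilon> :: real assume "0 < \<epsilon>"
    \<comment> \<open>The \<open>+ 1\<close> keeps the quotient meaningful for \<open>K = 0\<close>
      and still gives \<open>K * \<delta> \<le> \<epsilon>\<close>.\<close>
    define \<delta> where "\<delta> = \<epsilon> / (K + 1)"
    have "0 < \<delta>" "K * \<delta> \<le> \<epsilon>" using \<open>0 < \<epsilon>\<close> \<open>0 \<le> K\<close> by (auto simp: \<delta>_def field_simps)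
    obtain P where P: "P \<in> couplings Q1 Q2"
      and cost: "(\<integral>\<^sup>+z. ennreal (norm1 (fst z - snd z)) \<partial>P) \<le> ennreal (\<kappa> + \<delta>)"
      using near_optimal_coupling[OF W \<open>0 < \<delta>\<close>] .
    have [measurable_cong]: "sets P = sets (borel \<Otimes>\<^sub>M borel)" using P by (simp add: couplings_def)
    have Q1: "Q1 = distr P borel fst" using P by (simp add: couplings_def)
    have "?I \<le> (\<integral>\<^sup>+z. ennreal (norm1 (fst z - snd z)) \<partial>distr P (borel \<Otimes>\<^sub>M borel) (\<lambda>z. (a (fst z), b (snd z))))"
      by (rule INF_lower[OF distr_coupling[OF P]]) simp_all
    also have "\<dots> = (\<integral>\<^sup>+z. ennreal (norm1 (a (fst z) - b (snd z))) \<partial>P)"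
      by (subst nn_integral_distr) simp_all
    also have "\<dots> \<le> (\<integral>\<^sup>+z. ennreal K * ennreal (norm1 (fst z - snd z)) + ennreal (c (fst z)) \<partial>P)"
      using le \<open>0 \<le> K\<close> \<open>\<And>x. 0 \<le> c x\<close>
      by (intro nn_integral_mono) (simp add: ennreal_leI flip: ennreal_mult ennreal_plus)
    also have "\<dots> = ennreal K * (\<integral>\<^sup>+z. ennreal (norm1 (fst z - snd z)) \<partial>P) + (\<integral>\<^sup>+z. ennreal (c (fst z)) \<partial>P)"
      by (simp add: nn_integral_add nn_integral_cmult)
    also have "(\<integral>\<^sup>+z. ennreal (c (fst z)) \<partial>P) = ennreal m"
      using c(1) unfolding Q1 by (simp add: nn_integral_distr)
    also have "ennreal K * (\<integral>\<^sup>+z. ennreal (norm1 (fst z - snd z)) \<partial>P) + ennreal m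
        \<le> ennreal K * ennreal (\<kappa> + \<delta>) + ennreal m"
      by (intro add_mono mult_left_mono cost) auto
    also have "\<dots> = ennreal (K * (\<kappa> + \<delta>) + m)"
      using \<open>0 \<le> K\<close> \<open>0 \<le> \<kappa>\<close> \<open>0 < \<delta>\<close> \<open>0 \<le> m\<close> by (simp add: ennreal_mult)
    also have "\<dots> \<le> ennreal (K * \<kappa> + m) + ennreal \<epsilon>"
    proof -
      have "K * (\<kappa> + \<delta>) + m \<le> (K * \<kappa> + m) + \<epsilon>" using \<open>K * \<delta> \<le> \<epsilon>\<close> by (simp add: distrib_left)
      then show ?thesis
        using \<open>0 \<le> K\<close> \<open>0 \<le> \<kappa>\<close> \<open>0 < \<epsilon>\<close> \<open>0 \<le> m\<close>
        by (simp add: ennreal_leI del: ennreal_plus flip: ennreal_plus)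
    qed
    finally show "?I \<le> ennreal (K * \<kappa> + m) + ennreal \<epsilon>" .
  qed
  then show ?thesis
    using \<open>0 \<le> K\<close> \<open>0 \<le> \<kappa>\<close> \<open>0 \<le> m\<close> by (simp add: wasserstein_le_iff)
qed

section \<open>Expectations of Lipschitz functions over the ball\<close>

lemma integrable_lipschitz1:
  assumes "Q \<in> finite_mean_dists" "lipschitz1 l f"
  shows "integrable Q f"
proof -
  interpret prob_space Q using assms by (simp add: finite_mean_dists_def)
  have [measurable_cong]: "sets Q = sets borel" using assms by (simp add: finite_mean_dists_def)
  have [measurable]: "f \<in> borel_measurable borel" using assms(2) by (rule borel_measurable_lipschitz1)
  have "integrable Q norm1"
    using assms(1) by (intro integrableI_nonneg) (auto simp: finite_mean_dists_def)
  \<comment> \<open>Comparison with the value at \<open>0\<close> makes this an integrable majorant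
    of \<open>f\<close>.\<close>
  then have "integrable Q (\<lambda>x. \<bar>f 0\<bar> + l * norm1 x)" by simp
  then show ?thesis
  proof (rule Bochner_Integration.integrable_bound)
    show "AE x in Q. norm (f x) \<le> norm (\<bar>f 0\<bar> + l * norm1 x)"
    proof (intro always_eventually allI)
      fix x
      have "\<bar>f x - f 0\<bar> \<le> l * norm1 (x - 0)" using assms(2) unfolding lipschitz1_def by blast
      then show "norm (f x) \<le> norm (\<bar>f 0\<bar> + l * norm1 x)" by simp
    qed
  qed simp
qed

text \<open>The easy half of Kantorovich duality.\<close>
lemma integral_le_wasserstein:
  assumes Q: "Q \<in> finite_mean_dists" and W: "wasserstein Q Q0 \<le> ereal \<epsilon>"
    and f: "lipschitz1 l f" and Q0: "integrable Q0 f"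
  shows "(\<integral>x. f x \<partial>Q) \<le> l * \<epsilon> + (\<integral>x. f x \<partial>Q0)"
proof (rule field_le_epsilon)
  fix d :: real assume "0 < d"
  have l: "0 \<le> l" and lip: "\<And>x y. f x - f y \<le> l * norm1 (x - y)"
    using f by (auto simp: lipschitz1_def abs_le_iff)
  define \<delta> where "\<delta> = d / (l + 1)"
  have "0 < \<delta>" "l * \<delta> \<le> d" using \<open>0 < d\<close> \<open>0 \<le> l\<close> by (auto simp: \<delta>_def field_simps)
  obtain P where P: "P \<in> couplings Q Q0"
    and cost: "(\<integral>\<^sup>+z. ennreal (norm1 (fst z - snd z)) \<partial>P) \<le> ennreal (\<epsilon> + \<delta>)"
    using near_optimal_coupling[OF W \<open>0 < \<delta>\<close>] .
  have "0 \<le> \<epsilon>" using order_trans[OF wasserstein_nonneg W] by simp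
  have [measurable_cong]: "sets P = sets (borel \<Otimes>\<^sub>M borel)" using P by (simp add: couplings_def)
  have marg: "Q = distr P borel fst" "Q0 = distr P borel snd" using P by (auto simp: couplings_def)
  have [measurable]: "f \<in> borel_measurable borel" using f by (rule borel_measurable_lipschitz1)
  have int: "integrable P (\<lambda>z. f (fst z))" "integrable P (\<lambda>z. f (snd z))"
    using integrable_lipschitz1[OF Q f] Q0 unfolding marg by (auto simp: integrable_distr_eq)
  \<comment> \<open>The near-optimal coupling has finite cost, which allows passing from
    \<open>ennreal\<close> to real integrals.\<close>
  have int_cost: "integrable P (\<lambda>z. norm1 (fst z - snd z))"
    using cost by (intro integrableI_nonneg) (auto intro: le_less_trans)
  have cost_le: "(\<integral>z. norm1 (fst z - snd z) \<partial>P) \<le> \<epsilon> + \<delta>"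
    using cost \<open>0 \<le> \<epsilon>\<close> \<open>0 < \<delta>\<close> int_cost by (simp add: nn_integral_eq_integral del: ennreal_plus)
  have "(\<integral>x. f x \<partial>Q) - (\<integral>x. f x \<partial>Q0) = (\<integral>z. f (fst z) - f (snd z) \<partial>P)"
    using int unfolding marg by (simp add: integral_distr)
  also have "\<dots> \<le> (\<integral>z. l * norm1 (fst z - snd z) \<partial>P)"
    using int int_cost lip by (intro integral_mono) auto
  also have "\<dots> \<le> l * (\<epsilon> + \<delta>)"
    unfolding integral_mult_right_zero by (rule mult_left_mono[OF cost_le l])
  also have "\<dots> \<le> l * \<epsilon> + d" using \<open>l * \<delta> \<le> d\<close> by (simp add: distrib_left)
  finally show "(\<integral>x. f x \<partial>Q) \<le> l * \<epsilon> + (\<integral>x. f x \<partial>Q0) + d" by simp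
qed

text \<open>Serves both \<open>h\<close> and \<open>g\<close>, with \<open>s\<close> their epigraph
  variables. For negative \<open>\<epsilon>\<close> the ball is empty and the supremum is minus
  infinity.\<close>

lemma worst_case_empirical_le:
  fixes \<xi> :: "'k::finite \<Rightarrow> real ^ 'i::finite"
  assumes f: "lipschitz1 l f" and le: "\<And>k. f (\<xi> k) \<le> s k"
  shows "worst_case \<epsilon> (empirical \<xi>) f \<le> ereal (l * \<epsilon> + 1 / real CARD('k) * (\<Sum>k\<in>UNIV. s k))"
  unfolding worst_case_def
proof (rule SUP_least)
  fix Q assume "Q \<in> wball \<epsilon> (empirical \<xi>)"
  then have "(\<integral>x. f x \<partial>Q) \<le> l * \<epsilon> + (\<integral>x. f x \<partial>empirical \<xi>)"
    using f by (intro integral_le_wasserstein)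
      (auto simp: wball_def intro: integral_empirical borel_measurable_lipschitz1)
  also have "(\<integral>x. f x \<partial>empirical \<xi>) = (\<Sum>k\<in>UNIV. f (\<xi> k)) / real CARD('k)"
    using f by (intro integral_empirical borel_measurable_lipschitz1)
  also have "\<dots> \<le> (\<Sum>k\<in>UNIV. s k) / real CARD('k)"
    by (intro divide_right_mono sum_mono le) simp
  finally show "ereal (\<integral>x. f x \<partial>Q) \<le> ereal (l * \<epsilon> + 1 / real CARD('k) * (\<Sum>k\<in>UNIV. s k))" by simp
qed

subsection \<open>Convexity of the program\<close>

lemma convex_on_linear_comp:
  assumes "linear T" "convex_on UNIV f"
  shows "convex_on UNIV (\<lambda>z. f (T z))"
proof (rule convex_onI)
  fix t :: real and x y
  assume "0 < t" "t < 1"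
  then show "f (T ((1 - t) *\<^sub>R x + t *\<^sub>R y)) \<le> (1 - t) * f (T x) + t * f (T y)"
    using convex_onD[OF assms(2), of t "T x" "T y"]
    by (simp add: linear_add[OF assms(1)] linear_cmul[OF assms(1)])
qed simp

lemma convex_on_linear: "linear f \<Longrightarrow> convex_on UNIV (f :: 'a::real_vector \<Rightarrow> real)"
  using convex_on_linear_comp[of f "\<lambda>x. x"] by (simp add: convex_on_ident)

lemma convex_on_relax_obj: "convex_on UNIV (relax_obj lh)"
  unfolding relax_obj_def case_prod_beta
  by (intro convex_on_linear linearI) (simp_all add: algebra_simps sum.distrib sum_distrib_left)

text \<open>With the data fixed, the bound is a combination of \<open>mnorm1 \<Phi>\<close> and
  \<open>norm1 (u_part \<phi>)\<close>; the sign conditions make both coefficients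
  nonnegative.\<close>

lemma convex_on_radius_bound:
  fixes \<Theta>h :: "('t::{finite, linorder}, 'q::finite, 'q) bmat" and es :: "'k::finite \<Rightarrow> ('t, 'q) traj"
  assumes "\<gamma>1 > 0" "\<gamma>2 \<ge> 0" "\<gamma>3 \<ge> 0" "\<kappa> \<ge> 0" "0 \<le> \<rho>" "\<rho> < 1" "\<sigma> > 0"
  shows "convex_on UNIV (\<lambda>z :: ('t, 'q, 'm::finite, 'k) decision.
    radius_bound \<gamma>1 \<gamma>2 \<gamma>3 \<kappa> \<rho> \<sigma> \<Theta>h y0h es (fst (snd z)) (fst (snd (snd z))))"
proof -
  define a where "a = 1 / (real CARD('k) * (1 - \<rho>))
      * ((\<Sum>k\<in>UNIV. \<rho> * norm1 (y0h + \<Theta>h *v es k) + \<gamma>2 * norm1 (es k)) + real CARD('k) * \<gamma>3)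
    + \<kappa> / (1 - \<rho>) * (mnorm1 \<Theta>h + \<gamma>2)"
  define b where "b = (\<rho> / \<gamma>1 + \<sigma>) * (\<gamma>1 / (1 - \<rho>))"
  have "0 \<le> a" "0 \<le> b"
    unfolding a_def b_def using assms
    by (auto intro!: add_nonneg_nonneg mult_nonneg_nonneg divide_nonneg_nonneg sum_nonneg)
  have eq: "radius_bound \<gamma>1 \<gamma>2 \<gamma>3 \<kappa> \<rho> \<sigma> \<Theta>h y0h es \<Phi> \<phi> = a * mnorm1 \<Phi> + b * norm1 (u_part \<phi>)"
    for \<Phi> :: "('t, 'q, 'm) resp" and \<phi>
    by (simp add: radius_bound_def a_def b_def algebra_simps)
  show ?thesis
    unfolding eq
    by (intro convex_on_add convex_on_cmul \<open>0 \<le> a\<close> \<open>0 \<le> b\<close>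
        convex_on_linear_comp[OF _ convex_on_mnorm1] convex_on_linear_comp[OF _ convex_on_norm1] linearI)
      simp_all
qed

text \<open>For a fixed sample the nominal response is jointly linear in \<open>\<Phi>\<close> and
  \<open>\<phi>\<close>, since the known vector \<open>y0h + \<Theta>h *v e\<close> only multiplies
  \<open>\<Phi>\<close>.\<close>

lemma convex_on_response_minus_linear:
  fixes f :: "('t::{finite, linorder}, 'q::finite, 'm::finite) io \<Rightarrow> real"
  assumes "convex_on UNIV f" "linear l"
  shows "convex_on UNIV (\<lambda>z :: ('t, 'q, 'm, 'k::finite) decision.
    f (nominal_response \<Theta>h y0h (fst (snd z)) (fst (snd (snd z))) e) - l z)"
proof -
  have "linear (\<lambda>z :: ('t, 'q, 'm, 'k) decision.
      nominal_response \<Theta>h y0h (fst (snd z)) (fst (snd (snd z))) e)"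
    by (rule linearI)
      (simp_all add: nominal_response_def matrix_vector_mult_add_rdistrib scaleR_right_distrib
        flip: scaleR_matrix_vector_assoc)
  moreover have "linear (\<lambda>z. - l z)" using assms(2) by (rule linear_compose_neg)
  ultimately show ?thesis
    unfolding diff_conv_add_uminus
    by (intro convex_on_add convex_on_linear_comp[OF _ assms(1)] convex_on_linear)
qed

lemma convex_on_relax_ineqs:
  fixes \<Theta>h :: "('t::{finite, linorder}, 'q::finite, 'q) bmat" and es :: "'k::finite \<Rightarrow> ('t, 'q) traj"
    and h g :: "('t, 'q, 'm::finite) io \<Rightarrow> real"
  assumes "\<gamma>1 > 0" "\<gamma>2 \<ge> 0" "\<gamma>3 \<ge> 0" "\<kappa> \<ge> 0" "0 \<le> \<rho>" "\<rho> < 1" "\<sigma> > 0"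
    and "convex_on UNIV h" "convex_on UNIV g"
    and c: "c \<in> relax_ineqs \<gamma>1 \<gamma>2 \<gamma>3 \<kappa> \<rho> \<sigma> lg h g \<Theta>h y0h es"
  shows "convex_on UNIV c"
proof -
  let ?sr = "\<lambda>z :: ('t, 'q, 'm, 'k) decision. snd (snd (snd z))"
  have lin: "linear (\<lambda>z. fst (?sr z) $ k)" "linear (\<lambda>z. snd (?sr z) $ k)" for k
    by (intro linearI; simp)+
  have budget: "convex_on UNIV (\<lambda>z. lg * fst z + 1 / real CARD('k) * (\<Sum>k\<in>UNIV. snd (?sr z) $ k))"
    by (intro convex_on_linear linearI) (simp_all add: algebra_simps sum.distrib sum_distrib_left)
  have radius: "convex_on UNIV (\<lambda>z :: ('t, 'q, 'm, 'k) decision.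
      radius_bound \<gamma>1 \<gamma>2 \<gamma>3 \<kappa> \<rho> \<sigma> \<Theta>h y0h es (fst (snd z)) (fst (snd (snd z))) - fst z)"
    unfolding diff_conv_add_uminus
    by (intro convex_on_add convex_on_radius_bound assms convex_on_linear linearI) simp_all
  have Y: "convex_on UNIV (\<lambda>z :: ('t, 'q, 'm, 'k) decision. mnorm1 (y_part (fst (snd z))) - \<sigma>)"
    unfolding diff_conv_add_uminus
    by (intro convex_on_add convex_on_linear_comp[OF _ convex_on_mnorm1] linearI)
      (simp_all add: convex_on_const)
  have U: "convex_on UNIV (\<lambda>z :: ('t, 'q, 'm, 'k) decision. \<gamma>1 * mnorm1 (u_part (fst (snd z))) - \<rho>)"
    unfolding diff_conv_add_uminus
    using \<open>\<gamma>1 > 0\<close>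
    by (intro convex_on_add convex_on_cmul convex_on_linear_comp[OF _ convex_on_mnorm1] linearI)
      (simp_all add: convex_on_const)
  show ?thesis
    using c convex_on_response_minus_linear[OF assms(8) lin(1)]
      convex_on_response_minus_linear[OF assms(9) lin(2)] budget radius Y U
    unfolding relax_ineqs_def case_prod_beta by blast
qed

section \<open>The equality constraints\<close>

lemma matrix_mult_combination:
  fixes A :: "real ^ 'b::finite ^ 'a::finite" and X Y :: "real ^ 'c::finite ^ 'b"
  shows "A ** (u *\<^sub>R X + v *\<^sub>R Y) = u *\<^sub>R (A ** X) + v *\<^sub>R (A ** Y)"
  by (simp add: matrix_matrix_mult_def vec_eq_iff sum.distrib sum_distrib_left algebra_simps)

lemma affine_relax_eqs: "affine (relax_eqs Gh)"
proof -
  have "achievable Gh (u *\<^sub>R \<Phi> + v *\<^sub>R \<Phi>') (u *\<^sub>R \<phi> + v *\<^sub>R \<phi>')"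
    if a: "achievable Gh \<Phi> \<phi>" and b: "achievable Gh \<Phi>' \<phi>'" and "u + v = 1" for \<Phi> \<Phi>' \<phi> \<phi>' u v
  proof -
    have "y_part (u *\<^sub>R \<Phi> + v *\<^sub>R \<Phi>') - Gh ** u_part (u *\<^sub>R \<Phi> + v *\<^sub>R \<Phi>')
        = u *\<^sub>R (y_part \<Phi> - Gh ** u_part \<Phi>) + v *\<^sub>R (y_part \<Phi>' - Gh ** u_part \<Phi>')"
      by (simp add: matrix_mult_combination algebra_simps)
    \<comment> \<open>The only inhomogeneous equation: its right-hand side survives because
      \<open>u + v = 1\<close>.\<close>
    also have "\<dots> = mat 1"
      using a b \<open>u + v = 1\<close> by (simp add: achievable_def flip: scaleR_left_distrib)
    finally have "y_part (u *\<^sub>R \<Phi> + v *\<^sub>R \<Phi>') - Gh ** u_part (u *\<^sub>R \<Phi> + v *\<^sub>R \<Phi>') = mat 1" .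
    moreover have "y_part (u *\<^sub>R \<phi> + v *\<^sub>R \<phi>') - Gh *v u_part (u *\<^sub>R \<phi> + v *\<^sub>R \<phi>')
        = u *\<^sub>R (y_part \<phi> - Gh *v u_part \<phi>) + v *\<^sub>R (y_part \<phi>' - Gh *v u_part \<phi>')"
      by (simp add: algebra_simps)
    ultimately show ?thesis
      using a b by (auto simp: achievable_def block_lower_tri_def block_strictly_lower_tri_def)
  qed
  then show ?thesis by (auto simp: affine_def relax_eqs_def)
qed

subsection \<open>Guarantees at feasible points\<close>

lemma block_lower_tri_achievable_invertible:
  assumes "block_lower_tri Gh" "achievable Gh \<Phi> \<phi>"
  shows "invertible (y_part \<Phi>)"
proof -
  have "y_part \<Phi> = mat 1 + Gh ** u_part \<Phi>" "block_strictly_lower_tri (u_part \<Phi>)"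
    using assms(2) by (simp_all add: achievable_def algebra_simps)
  then show ?thesis
    using invertible_one_plus_strictly_lower[OF block_lower_tri_mult_strict[OF assms(1)]] by simp
qed

lemma borel_measurable_responses:
  "nominal_response \<Theta>h y0h \<Phi> \<phi> \<in> borel_measurable borel"
  "true_response \<Delta> \<Theta> y0 \<Phi> \<phi> \<in> borel_measurable borel"
  unfolding nominal_response_def[abs_def] true_response_def[abs_def]
  by (intro borel_measurable_continuous_onI continuous_intros
      bounded_linear.continuous_on[OF matrix_vector_mul_bounded_linear])+

text \<open>The empirical measure is the first marginal, so the remainder \<open>c\<close> becomes a
  computable sample average, while the unknown \<open>Pe\<close> enters only through
  \<open>\<kappa>\<close>.\<close>

lemma wasserstein_nominal_true_le:
  fixes \<Delta> :: "('t::{finite, linorder}, 'q::finite, 'm::finite) bmat" and \<Phi> :: "('t, 'q, 'm) resp"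
    and es :: "'k::finite \<Rightarrow> ('t, 'q) traj"
  assumes "\<gamma>1 > 0" "\<gamma>2 \<ge> 0" "\<gamma>3 \<ge> 0" "0 \<le> \<rho>" "\<rho> < 1" "\<sigma> > 0"
    and err: "mnorm1 \<Delta> \<le> \<gamma>1" "mnorm1 (\<Theta> - \<Theta>h) \<le> \<gamma>2" "norm1 (y0 - y0h) \<le> \<gamma>3"
    and bounds: "mnorm1 (y_part \<Phi>) \<le> \<sigma>" "\<gamma>1 * mnorm1 (u_part \<Phi>) \<le> \<rho>"
    and W: "wasserstein (empirical es) Pe \<le> ereal \<kappa>"
  shows "wasserstein (nominal_dist \<Theta>h y0h es \<Phi> \<phi>) (true_dist \<Delta> \<Theta> y0 Pe \<Phi> \<phi>)
    \<le> ereal (radius_bound \<gamma>1 \<gamma>2 \<gamma>3 \<kappa> \<rho> \<sigma> \<Theta>h y0h es \<Phi> \<phi>)"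
proof -
  define b where "b = (\<rho> / \<gamma>1 + \<sigma>) * (\<gamma>1 / (1 - \<rho>)) * norm1 (u_part \<phi>)"
  define c where "c e = mnorm1 \<Phi> / (1 - \<rho>) * (\<rho> * norm1 (y0h + \<Theta>h *v e) + \<gamma>2 * norm1 e + \<gamma>3) + b" for e
  define K where "K = mnorm1 \<Phi> * (mnorm1 \<Theta>h + \<gamma>2) / (1 - \<rho>)"
  have c_nonneg: "0 \<le> c e" for e
    unfolding c_def b_def using assms(1-6) by (auto intro!: add_nonneg_nonneg mult_nonneg_nonneg divide_nonneg_nonneg)
  have K_nonneg: "0 \<le> K" using assms(2,5) by (simp add: K_def)
  have c_meas: "c \<in> borel_measurable borel"
    unfolding c_def[abs_def]
    by (intro borel_measurable_continuous_onI continuous_intros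
        bounded_linear.continuous_on[OF matrix_vector_mul_bounded_linear])
  have "wasserstein (distr (empirical es) borel (nominal_response \<Theta>h y0h \<Phi> \<phi>))
      (distr Pe borel (true_response \<Delta> \<Theta> y0 \<Phi> \<phi>))
    \<le> ereal (K * \<kappa> + (\<Sum>k\<in>UNIV. c (es k)) / real CARD('k))"
  proof (rule wasserstein_distr_le[OF W borel_measurable_responses c_meas K_nonneg c_nonneg])
    show "norm1 (nominal_response \<Theta>h y0h \<Phi> \<phi> x - true_response \<Delta> \<Theta> y0 \<Phi> \<phi> y) \<le> K * norm1 (x - y) + c x"
      for x y
      unfolding K_def c_def b_def by (rule response_deviation) (use assms in auto)
  qed (simp_all add: nn_integral_empirical c_meas c_nonneg sum_nonneg)
  also have "(\<Sum>k\<in>UNIV. c (es k)) = mnorm1 \<Phi> / (1 - \<rho>)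
      * ((\<Sum>k\<in>UNIV. \<rho> * norm1 (y0h + \<Theta>h *v es k) + \<gamma>2 * norm1 (es k)) + real CARD('k) * \<gamma>3)
      + real CARD('k) * b"
    by (simp only: c_def sum.distrib sum_constant flip: sum_distrib_left)
  \<comment> \<open>The three terms of the radius are, in order, the averaged model error,
    \<open>b\<close>, and \<open>K * \<kappa>\<close>.\<close>
  also have "K * \<kappa> + \<dots> / real CARD('k) = radius_bound \<gamma>1 \<gamma>2 \<gamma>3 \<kappa> \<rho> \<sigma> \<Theta>h y0h es \<Phi> \<phi>"
    by (simp add: radius_bound_def K_def b_def add_divide_distrib ac_simps)
  finally show ?thesis
    by (simp add: nominal_dist_def true_dist_def empirical_comp borel_measurable_responses)
qed

theorem theorem3:
  fixes A :: "real ^ 'n::finite ^ 'n" and B :: "real ^ 'm::finite ^ 'n"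
    and C :: "real ^ 'n ^ 'q::finite" and D :: "real ^ 'm ^ 'q" and L :: "real ^ 'q ^ 'n"
    and G Gh :: "('t::{finite, linorder}, 'q, 'm) bmat"
    and \<Theta> \<Theta>h :: "('t, 'q, 'q) bmat"
    and y0 y0h :: "('t, 'q) traj"
    and \<gamma>1 \<gamma>2 \<gamma>3 \<kappa> \<alpha> \<beta> \<rho> \<sigma> lh lg :: real
    and Pe :: "('t, 'q) traj measure"
    and es :: "'k::finite \<Rightarrow> ('t, 'q) traj"
    and h g :: "('t, 'q, 'm) io \<Rightarrow> real"
  assumes true_G: "G = stacked_G A B C D"
    and true_Theta: "\<Theta> = stacked_Theta A L C"
    and nominal_G: "block_lower_tri Gh"
    and gammas: "\<gamma>1 > 0" "\<gamma>2 \<ge> 0" "\<gamma>3 \<ge> 0" "\<kappa> \<ge> 0"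
    and innovation_dist: "prob_space Pe" "sets Pe = sets borel"
    and light_tail: "\<alpha> > 1" "\<beta> > 0"
      "(\<integral>\<^sup>+e. ennreal (exp (\<beta> * norm1 e powr \<alpha>)) \<partial>Pe) < \<infinity>"
    and sample_dist: "wasserstein (empirical es) Pe \<le> ereal \<kappa>"
    and model_error: "mnorm1 (G - Gh) \<le> \<gamma>1" "mnorm1 (\<Theta> - \<Theta>h) \<le> \<gamma>2" "norm1 (y0 - y0h) \<le> \<gamma>3"
    and cost_h: "convex_on UNIV h" "lipschitz1 lh h"
    and constraint_g: "convex_on UNIV g" "lipschitz1 lg g"
    and rho_sigma: "0 \<le> \<rho>" "\<rho> < 1" "\<sigma> > 0"
  shows
    "convex_program (relax_obj lh :: ('t, 'q, 'm, 'k) decision \<Rightarrow> real)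
       (relax_ineqs \<gamma>1 \<gamma>2 \<gamma>3 \<kappa> \<rho> \<sigma> lg h g \<Theta>h y0h es) (relax_eqs Gh) \<and>
     (\<forall>\<epsilon> \<Phi> \<phi> s r.
        (\<epsilon>, \<Phi>, \<phi>, s, r) \<in> program_feasible
           (relax_ineqs \<gamma>1 \<gamma>2 \<gamma>3 \<kappa> \<rho> \<sigma> lg h g \<Theta>h y0h es) (relax_eqs Gh) \<longrightarrow>
        wasserstein (nominal_dist \<Theta>h y0h es \<Phi> \<phi>) (true_dist (G - Gh) \<Theta> y0 Pe \<Phi> \<phi>) \<le> ereal \<epsilon> \<and>
        dr_sls_feasible \<epsilon> g G \<Theta> y0 Gh \<Theta>h y0h es \<Phi> \<phi> \<and>
        dr_sls_cost \<epsilon> h \<Theta>h y0h es \<Phi> \<phi> \<le> ereal (relax_obj lh (\<epsilon>, \<Phi>, \<phi>, s, r)))"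
proof (intro conjI allI impI)
  show "convex_program (relax_obj lh :: ('t, 'q, 'm, 'k) decision \<Rightarrow> real)
      (relax_ineqs \<gamma>1 \<gamma>2 \<gamma>3 \<kappa> \<rho> \<sigma> lg h g \<Theta>h y0h es) (relax_eqs Gh)"
    unfolding convex_program_def
    using convex_on_relax_obj affine_relax_eqs
      convex_on_relax_ineqs[OF gammas rho_sigma cost_h(1) constraint_g(1)] by blast
next
  fix \<epsilon> \<Phi> \<phi> s r
  assume feas: "(\<epsilon>, \<Phi>, \<phi>, s, r) \<in> program_feasible
      (relax_ineqs \<gamma>1 \<gamma>2 \<gamma>3 \<kappa> \<rho> \<sigma> lg h g \<Theta>h y0h es) (relax_eqs Gh)"
  then have ach: "achievable Gh \<Phi> \<phi>"
    and hs: "\<And>k. h (nominal_response \<Theta>h y0h \<Phi> \<phi> (es k)) \<le> s $ k"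
    and gr: "\<And>k. g (nominal_response \<Theta>h y0h \<Phi> \<phi> (es k)) \<le> r $ k"
    and budget: "lg * \<epsilon> + 1 / real CARD('k) * (\<Sum>k\<in>UNIV. r $ k) \<le> 0"
    and radius: "radius_bound \<gamma>1 \<gamma>2 \<gamma>3 \<kappa> \<rho> \<sigma> \<Theta>h y0h es \<Phi> \<phi> \<le> \<epsilon>"
    and bounds: "mnorm1 (y_part \<Phi>) \<le> \<sigma>" "\<gamma>1 * mnorm1 (u_part \<Phi>) \<le> \<rho>"
    by (auto simp: program_feasible_def relax_ineqs_def relax_eqs_def)
  show "wasserstein (nominal_dist \<Theta>h y0h es \<Phi> \<phi>) (true_dist (G - Gh) \<Theta> y0 Pe \<Phi> \<phi>) \<le> ereal \<epsilon>"
    by (rule order_trans[OF wasserstein_nominal_true_le[OF gammas(1-3) rho_sigma model_error bounds sample_dist]])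
      (use radius in simp)
  show "dr_sls_cost \<epsilon> h \<Theta>h y0h es \<Phi> \<phi> \<le> ereal (relax_obj lh (\<epsilon>, \<Phi>, \<phi>, s, r))"
    using worst_case_empirical_le[OF cost_h(2) hs]
    by (simp add: dr_sls_cost_def nominal_dist_def relax_obj_def)
  have "worst_case \<epsilon> (nominal_dist \<Theta>h y0h es \<Phi> \<phi>) g \<le> 0"
    unfolding nominal_dist_def
    by (rule order_trans[OF worst_case_empirical_le[OF constraint_g(2) gr]])
      (use budget in \<open>simp add: zero_ereal_def\<close>)
  moreover have inv_y: "invertible (y_part \<Phi>)"
    using nominal_G ach by (rule block_lower_tri_achievable_invertible)
  \<comment> \<open>Together with \<open>inv_y\<close>, this makes every \<open>matrix_inv\<close>
    in the policy and in the response a genuine inverse.\<close>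
  moreover have inv_R: "invertible (mat 1 - (G - Gh) ** u_part \<Phi>)"
    using rho_sigma(2) contraction_model_error[OF model_error(1) bounds(2)]
    by (rule invertible_one_minus_contraction)
  ultimately show "dr_sls_feasible \<epsilon> g G \<Theta> y0 Gh \<Theta>h y0h es \<Phi> \<phi>"
    unfolding dr_sls_feasible_def using ach closed_loop_iff_true_response[OF ach inv_y inv_R] by blast
qed

end
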